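(* Let $n\ge0$, $0\le k\le n$, $I=\{i_0<\dots<i_k\}\subset\{0,\dots,n\}$. The stellar welding maps on cochains $i^\star:C^\bullet(\Delta^n)\to C^\bullet(\star_{i_0,\dots,i_k}\Delta^n)$ (inclusion), $p^\star:C^\bullet(\star_{i_0,\dots,i_k}\Delta^n)\to C^\bullet(\Delta^n)$ (projection) and $a^\star:C^\bullet(\star_{i_0,\dots,i_k}\Delta^n)\to C^{\bullet-1}(\star_{i_0,\dots,i_k}\Delta^n)$ (homotopy) define a special deformation retraction of $(C^\bullet(\star_{i_0,\dots,i_k}\Delta^n),d)$ onto $(C^\bullet(\Delta^n),d)$; that is, $i^\star,p^\star$ are cochain maps and $$p^\star i^\star=1,\quad da^\star+a^\star d=1-i^\star p^\star,\quad (a^\star)^2=0,\quad a^\star i^\star=0,\quad p^\star a^\star=0.$$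
   Context: $\Delta^n$ is the $n$-simplex with vertices $e_0,\dots,e_n$. The stellar subdivision $\star_{i_0,\dots,i_k}\Delta^n$ is the simplicial complex with vertices $e_\star,e_0,\dots,e_n$ whose simplices are $[e_{j_0},\dots,e_{j_l}]$ and $[e_\star,e_{j_0},\dots,e_{j_l}]$ for all $J=\{j_0,\dots,j_l\}\subset\{0,\dots,n\}$ with $J\not\supset I$ (in the second type $J=\emptyset$, $l=-1$, is allowed). $C^\bullet(X)$ is the dual of the complex of oriented simplicial chains with real coefficients, $d\alpha=\alpha\circ\partial$. For an oriented simplex $\sigma$, $\widehat\sigma$ (also written $\sigma^\wedge$) is the dual cochain, with $\widehat{-\sigma}=-\widehat\sigma$; a hat over a single vertex inside a bracket means omission. For $J=\{j_0<\dots<j_l\}$: $i^\star[e_{j_0},\dots,e_{j_l}]^\wedge=[e_{j_0},\dots,e_{j_l}]^\wedge+\frac1{k+1}\sum_{i:\,j_i\in I}(-1)^i[e_\star,e_{j_0},\dots,\widehat{e_{j_i}},\dots,e_{j_l}]^\wedge$ if $J\not\supset I$, and $i^\star[e_{j_0},\dots,e_{j_l}]^\wedge=\frac1{k+1}\sum_{i:\,j_i\in I}(-1)^i[e_\star,e_{j_0},\dots,\widehat{e_{j_i}},\dots,e_{j_l}]^\wedge$ if $J\supset I$. For $J\not\supset I$: $p^\star[e_{j_0},\dots,e_{j_l}]^\wedge=[e_{j_0},\dots,e_{j_l}]^\wedge$; $p^\star[e_\star,e_{j_0},\dots,e_{j_l}]^\wedge=[e_{i_m},e_{j_0},\dots,e_{j_l}]^\wedge$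 if $I\setminus J=\{i_m\}$, and $0$ otherwise. For $J\not\supset I$: $a^\star[e_{j_0},\dots,e_{j_l}]^\wedge=0$ and $a^\star[e_\star,e_{j_0},\dots,e_{j_l}]^\wedge=-\frac1{k+1}\sum_{i:\,j_i\in I}(-1)^i[e_\star,e_{j_0},\dots,\widehat{e_{j_i}},\dots,e_{j_l}]^\wedge$. *)

theory Defs
  imports Complex_Main "HOL-Combinatorics.Combinatorics"
begin

section \<open>Oriented simplicial chains and cochains\<close>

text \<open>
  A simplicial complex is given by its set X of nonempty finite simplices (sets of vertices).
  A list of distinct vertices spanning a simplex stands for that simplex with the orientation
  given by the order of the list. An oriented chain is a finitely supported function on such lists
  that changes by the sign of the permutation when the list is permuted: the value at a list is the
  coefficient of the corresponding oriented simplex. Degrees are integers, so that a map of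
  degree -1 is defined in degree 0; chains of negative degree are zero since X does not contain
  the empty set.
\<close>

type_synonym 'v chain = "'v list \<Rightarrow> real"
type_synonym 'v cochain = "'v chain \<Rightarrow> real"

definition chains :: "'v set set \<Rightarrow> int \<Rightarrow> 'v chain set" where
  "chains X q = {c. finite {xs. c xs \<noteq> 0} \<and>
     (\<forall>xs. c xs \<noteq> 0 \<longrightarrow> distinct xs \<and> set xs \<in> X \<and> int (length xs) = q + 1) \<and>
     (\<forall>xs \<pi>. \<pi> permutes {..<length xs} \<longrightarrow> c (permute_list \<pi> xs) = of_int (sign \<pi>) * c xs)}"

text \<open>The elementary chain of an oriented simplex: its value at a reordering of xs is the sign of
  the reordering, and it vanishes at all other lists.\<close>

definition oriented_simplex :: "'v list \<Rightarrow> 'v chain" where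
  "oriented_simplex xs =
     (\<lambda>ys. \<Sum>\<pi> | \<pi> permutes {..<length xs} \<and> permute_list \<pi> xs = ys. of_int (sign \<pi>))"

definition omit :: "nat \<Rightarrow> 'v list \<Rightarrow> 'v list" where
  "omit i xs = take i xs @ drop (Suc i) xs"

text \<open>The chain complex is not augmented: vertices have boundary zero.\<close>

definition simplex_boundary :: "'v list \<Rightarrow> 'v chain" where
  "simplex_boundary xs =
     (\<lambda>ys. if length xs \<le> 1 then 0
           else \<Sum>i<length xs. (-1) ^ i * oriented_simplex (omit i xs) ys)"

text \<open>The linear extension of the boundary of oriented simplices. The sum runs over all orderings
  of each simplex; by antisymmetry they all contribute equally, hence the division by their
  number.\<close>

definition boundary :: "'v chain \<Rightarrow> 'v chain" where
  "boundary c =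
     (\<lambda>ys. \<Sum>xs | c xs \<noteq> 0. c xs / fact (length xs) * simplex_boundary xs ys)"

text \<open>The dual space of the space of q-chains. A functional is represented by its extension by
  zero outside this space, so that equality of cochains is equality of functions.\<close>

definition cochains :: "'v set set \<Rightarrow> int \<Rightarrow> 'v cochain set" where
  "cochains X q = {\<alpha>.
     (\<forall>b\<in>chains X q. \<forall>c\<in>chains X q. \<forall>r s.
        \<alpha> (\<lambda>xs. r * b xs + s * c xs) = r * \<alpha> b + s * \<alpha> c) \<and>
     (\<forall>c. c \<notin> chains X q \<longrightarrow> \<alpha> c = 0)}"

definition coboundary :: "'v set set \<Rightarrow> int \<Rightarrow> 'v cochain \<Rightarrow> 'v cochain" where
  "coboundary X q \<alpha> = (\<lambda>c. if c \<in> chains X (q + 1) then \<alpha> (boundary c) else 0)"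

text \<open>The dual cochain of the oriented simplex xs maps a chain to its coefficient at xs.\<close>

definition dual_cochain :: "'v set set \<Rightarrow> int \<Rightarrow> 'v list \<Rightarrow> 'v cochain" where
  "dual_cochain X q xs = (\<lambda>c. if c \<in> chains X q then c xs else 0)"


section \<open>Special deformation retractions\<close>

text \<open>Real-linear maps between spaces of real-valued functions.\<close>

definition linear_map_on ::
    "('a \<Rightarrow> real) set \<Rightarrow> ('b \<Rightarrow> real) set \<Rightarrow> (('a \<Rightarrow> real) \<Rightarrow> ('b \<Rightarrow> real)) \<Rightarrow> bool" where
  "linear_map_on V W f \<longleftrightarrow>
     (\<forall>\<alpha>\<in>V. f \<alpha> \<in> W) \<and>
     (\<forall>\<alpha>\<in>V. \<forall>\<beta>\<in>V. \<forall>r s.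
        f (\<lambda>x. r * \<alpha> x + s * \<beta> x) = (\<lambda>y. r * f \<alpha> y + s * f \<beta> y))"

definition cochain_map ::
    "(int \<Rightarrow> ('a \<Rightarrow> real) set) \<Rightarrow> (int \<Rightarrow> ('a \<Rightarrow> real) \<Rightarrow> ('a \<Rightarrow> real)) \<Rightarrow>
     (int \<Rightarrow> ('b \<Rightarrow> real) set) \<Rightarrow> (int \<Rightarrow> ('b \<Rightarrow> real) \<Rightarrow> ('b \<Rightarrow> real)) \<Rightarrow>
     (int \<Rightarrow> ('a \<Rightarrow> real) \<Rightarrow> ('b \<Rightarrow> real)) \<Rightarrow> bool" where
  "cochain_map C dC D dD f \<longleftrightarrow>
     (\<forall>q. linear_map_on (C q) (D q) (f q)) \<and>
     (\<forall>q. \<forall>\<alpha>\<in>C q. dD q (f q \<alpha>) = f (q + 1) (dC q \<alpha>))"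

text \<open>A special deformation retraction of (C, dC) onto (D, dD) with inclusion i, projection p and
  homotopy a.\<close>

definition special_deformation_retraction ::
    "(int \<Rightarrow> ('a \<Rightarrow> real) set) \<Rightarrow> (int \<Rightarrow> ('a \<Rightarrow> real) \<Rightarrow> ('a \<Rightarrow> real)) \<Rightarrow>
     (int \<Rightarrow> ('b \<Rightarrow> real) set) \<Rightarrow> (int \<Rightarrow> ('b \<Rightarrow> real) \<Rightarrow> ('b \<Rightarrow> real)) \<Rightarrow>
     (int \<Rightarrow> ('b \<Rightarrow> real) \<Rightarrow> ('a \<Rightarrow> real)) \<Rightarrow>
     (int \<Rightarrow> ('a \<Rightarrow> real) \<Rightarrow> ('b \<Rightarrow> real)) \<Rightarrow>
     (int \<Rightarrow> ('a \<Rightarrow> real) \<Rightarrow> ('a \<Rightarrow> real)) \<Rightarrow> bool" where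
  "special_deformation_retraction C dC D dD i p a \<longleftrightarrow>
     cochain_map D dD C dC i \<and>
     cochain_map C dC D dD p \<and>
     (\<forall>q. linear_map_on (C q) (C (q - 1)) (a q)) \<and>
     (\<forall>q. \<forall>\<beta>\<in>D q. p q (i q \<beta>) = \<beta>) \<and>
     (\<forall>q. \<forall>\<alpha>\<in>C q.
        (\<lambda>x. dC (q - 1) (a q \<alpha>) x + a (q + 1) (dC q \<alpha>) x) = (\<lambda>x. \<alpha> x - i q (p q \<alpha>) x)) \<and>
     (\<forall>q. \<forall>\<alpha>\<in>C q. a (q - 1) (a q \<alpha>) = (\<lambda>x. 0)) \<and>
     (\<forall>q. \<forall>\<beta>\<in>D q. a q (i q \<beta>) = (\<lambda>x. 0)) \<and>
     (\<forall>q. \<forall>\<alpha>\<in>C q. p (q - 1) (a q \<alpha>) = (\<lambda>x. 0))"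


section \<open>Stellar subdivision of the simplex and the welding maps\<close>

datatype vertex = Star | E nat

definition simplex_complex :: "nat \<Rightarrow> vertex set set" where
  "simplex_complex n = {E ` J | J. J \<subseteq> {0..n} \<and> J \<noteq> {}}"

definition stellar_subdivision :: "nat \<Rightarrow> nat set \<Rightarrow> vertex set set" where
  "stellar_subdivision n I =
     {E ` J | J. J \<subseteq> {0..n} \<and> J \<noteq> {} \<and> \<not> I \<subseteq> J} \<union>
     {insert Star (E ` J) | J. J \<subseteq> {0..n} \<and> \<not> I \<subseteq> J}"

text \<open>The vertices of the face J in increasing order.\<close>

definition face_list :: "nat set \<Rightarrow> vertex list" where
  "face_list J = map E (sorted_list_of_set J)"

text \<open>The sum over the vertices of J lying in I that occurs in the formulas for the inclusion and
  the homotopy (card I is k + 1).\<close>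

definition star_sum :: "nat \<Rightarrow> nat set \<Rightarrow> int \<Rightarrow> nat set \<Rightarrow> vertex cochain" where
  "star_sum n I q J =
     (\<lambda>c. 1 / real (card I) *
        (\<Sum>i | i < card J \<and> sorted_list_of_set J ! i \<in> I.
           (-1) ^ i * dual_cochain (stellar_subdivision n I) q (Star # omit i (face_list J)) c))"

text \<open>For a degree q, the following are the values of the three maps on the dual cochain of
  the face J, respectively of the face J joined with the new vertex.\<close>

definition incl_face :: "nat \<Rightarrow> nat set \<Rightarrow> int \<Rightarrow> nat set \<Rightarrow> vertex cochain" where
  "incl_face n I q J =
     (\<lambda>c. (if I \<subseteq> J then 0 else dual_cochain (stellar_subdivision n I) q (face_list J) c)
          + star_sum n I q J c)"

definition proj_face :: "nat \<Rightarrow> nat set \<Rightarrow> int \<Rightarrow> nat set \<Rightarrow> vertex cochain" where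
  "proj_face n I q J = dual_cochain (simplex_complex n) q (face_list J)"

definition proj_star_face :: "nat \<Rightarrow> nat set \<Rightarrow> int \<Rightarrow> nat set \<Rightarrow> vertex cochain" where
  "proj_star_face n I q J =
     (if card (I - J) = 1
      then dual_cochain (simplex_complex n) q (E (the_elem (I - J)) # face_list J)
      else (\<lambda>c. 0))"

definition htpy_face :: "nat \<Rightarrow> nat set \<Rightarrow> int \<Rightarrow> nat set \<Rightarrow> vertex cochain" where
  "htpy_face n I q J = (\<lambda>c. 0)"

definition htpy_star_face :: "nat \<Rightarrow> nat set \<Rightarrow> int \<Rightarrow> nat set \<Rightarrow> vertex cochain" where
  "htpy_star_face n I q J = (\<lambda>c. - star_sum n I (q - 1) J c)"

text \<open>Linear extensions of these values, using that the dual cochains of the simplices (with the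
  chosen orientations) form a basis and that the coordinate of a cochain at a simplex is its value
  at the corresponding elementary chain.\<close>

definition faces :: "nat \<Rightarrow> int \<Rightarrow> nat set set" where
  "faces n q = {J. J \<subseteq> {0..n} \<and> int (card J) = q + 1}"

definition stellar_extend ::
    "nat \<Rightarrow> nat set \<Rightarrow> (nat set \<Rightarrow> vertex cochain) \<Rightarrow> (nat set \<Rightarrow> vertex cochain) \<Rightarrow>
     int \<Rightarrow> vertex cochain \<Rightarrow> vertex cochain" where
  "stellar_extend n I f g q \<alpha> =
     (\<lambda>c. (\<Sum>J | J \<in> faces n q \<and> J \<noteq> {} \<and> \<not> I \<subseteq> J.
             \<alpha> (oriented_simplex (face_list J)) * f J c) +
          (\<Sum>J | J \<in> faces n (q - 1) \<and> \<not> I \<subseteq> J.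
             \<alpha> (oriented_simplex (Star # face_list J)) * g J c))"

definition welding_incl :: "nat \<Rightarrow> nat set \<Rightarrow> int \<Rightarrow> vertex cochain \<Rightarrow> vertex cochain" where
  "welding_incl n I q \<beta> =
     (\<lambda>c. \<Sum>J | J \<in> faces n q \<and> J \<noteq> {}.
        \<beta> (oriented_simplex (face_list J)) * incl_face n I q J c)"

definition welding_proj :: "nat \<Rightarrow> nat set \<Rightarrow> int \<Rightarrow> vertex cochain \<Rightarrow> vertex cochain" where
  "welding_proj n I q = stellar_extend n I (proj_face n I q) (proj_star_face n I q) q"

definition welding_htpy :: "nat \<Rightarrow> nat set \<Rightarrow> int \<Rightarrow> vertex cochain \<Rightarrow> vertex cochain" where
  "welding_htpy n I q = stellar_extend n I (htpy_face n I q) (htpy_star_face n I q) q"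

end

(* Let A0 and A1 be the coefficients of a cochain of the subdivision on simplices without and with
   the new vertex (listed first), as alternating functions of lists of old vertices; let delta be the
   alternating sum over omitted entries and h the average over v in I of prepending v. By
   antisymmetry the welding maps become: i sends B to (B, h B), which is substitution of the
   barycentre of I for the new vertex; p sends (A0, A1) to delta A1 on simplices containing I and to
   A0 elsewhere; a sends (A0, A1) to (0, - h A1); and d sends (A0, A1) to (delta A0, A0 - delta A1).
   All required equations then follow from delta delta = 0, h h = 0, delta h + h delta = 1 and from
   alternating functions being zero on lists with repetitions. *)
theory Submission
  imports Defs
begin

section \<open>Alternating functions on lists\<close>

text \<open>The delicate lists are those containing I, which span no simplex of the subdivision:
  there the formula for d fails, yet an average over \<open>v # xs\<close> reaches them. The
  projection repairs this. With (dA)_1 the part of d(A0, A1) on simplices with the new vertex,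
  (dA)_1 = p A - delta A1 holds on all lists of old vertices, since p A = A0 on lists not containing
  I and both sides vanish on the others. Hence p d A = delta (p A - delta A1) = delta p A on faces
  containing I, and delta h A1 - h (dA)_1 = A1 - h p A, which is the homotopy formula. This requires
  coefficients at every list, also unsorted, degenerate or of the wrong length; alternation and the
  extension of cochains by zero supply them, so that each v in I can be prepended without tracking
  signs. The factor 1/(k+1) makes the weights of the barycentre add up to 1: delta h + h delta = 1
  is the average over v of the cone formula delta F (v # xs) = F xs - delta (F (v # _)) xs.\<close>

definition alternating :: "('v list \<Rightarrow> real) \<Rightarrow> bool" where
  "alternating F \<longleftrightarrow> (\<forall>us a b vs. F (us @ a # b # vs) = - F (us @ b # a # vs))"

text \<open>The augmented difference: on a singleton it has the term \<open>F []\<close>. For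
  coefficients after \<open>Star\<close> this term belongs to the vertex \<open>Star\<close>,
  whereas \<open>coef \<alpha> []\<close> is 0 for a cochain of a complex, in agreement with the
  boundary without augmentation.\<close>

definition codiff :: "('v list \<Rightarrow> real) \<Rightarrow> 'v list \<Rightarrow> real" where
  "codiff F xs = (\<Sum>i<length xs. (-1) ^ i * F (omit i xs))"

text \<open>Every \<open>v\<close> in \<open>I\<close> is summed, even if it occurs in
  \<open>xs\<close>; such terms vanish as soon as \<open>F\<close> is alternating.\<close>

definition avg :: "'v set \<Rightarrow> ('v list \<Rightarrow> real) \<Rightarrow> 'v list \<Rightarrow> real" where
  "avg I F xs = (\<Sum>v\<in>I. F (v # xs)) / real (card I)"

lemma omit_Cons_0 [simp]: "omit 0 (x # xs) = xs"
  by (simp add: omit_def)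

lemma omit_Cons_Suc [simp]: "omit (Suc i) (x # xs) = x # omit i xs"
  by (simp add: omit_def)

lemma length_omit: "i < length xs \<Longrightarrow> length (omit i xs) = length xs - 1"
  by (simp add: omit_def)

lemma map_omit: "omit i (map f xs) = map f (omit i xs)"
  by (simp add: omit_def take_map drop_map)

lemma split_at_index:
  assumes "i < length xs"
  obtains us v vs where "xs = us @ v # vs" "i = length us" "xs ! i = v" "omit i xs = us @ vs"
  using id_take_nth_drop[OF assms] assms by (auto simp: omit_def intro: that)

lemma distinct_omit: "distinct xs \<Longrightarrow> i < length xs \<Longrightarrow> distinct (omit i xs)"
  by (erule split_at_index) simp

lemma set_omit:
  assumes "distinct xs" "i < length xs"
  shows "set (omit i xs) = set xs - {xs ! i}"
  using assms(1) by (rule_tac split_at_index[OF assms(2)]) auto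

lemma alternating_swap: "alternating F \<Longrightarrow> F (us @ a # b # vs) = - F (us @ b # a # vs)"
  unfolding alternating_def by blast

lemma alternating_swap_front: "alternating F \<Longrightarrow> F (a # b # vs) = - F (b # a # vs)"
  using alternating_swap[of F "[]" a b vs] by simp

lemma alternatingI:
  "(\<And>us a b vs. F (us @ a # b # vs) = - F (us @ b # a # vs)) \<Longrightarrow> alternating F"
  unfolding alternating_def by blast

lemma alternating_Cons: "alternating F \<Longrightarrow> alternating (\<lambda>xs. F (x # xs))"
  by (rule alternatingI) (metis alternating_swap append_Cons)

lemma alternating_append: "alternating F \<Longrightarrow> alternating (\<lambda>xs. F (us @ xs))"
  by (rule alternatingI) (metis alternating_swap append_assoc)

lemma alternating_scale:
  assumes "alternating F"
  shows "alternating (\<lambda>xs. r * F xs)"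
proof (rule alternatingI)
  fix us vs :: "'a list" and a b
  show "r * F (us @ a # b # vs) = - (r * F (us @ b # a # vs))"
    using alternating_swap[OF assms, of us a b vs] by simp
qed

lemma alternating_map: "alternating F \<Longrightarrow> alternating (\<lambda>xs. F (map f xs))"
  by (rule alternatingI) (simp only: map_append list.map, rule alternating_swap)

text \<open>Each entry of \<open>us\<close> that \<open>v\<close> passes costs one adjacent
  swap.\<close>

lemma alternating_move:
  "alternating F \<Longrightarrow> F (us @ v # vs) = (-1) ^ length us * F (v # us @ vs)"
proof (induction us arbitrary: F)
  case (Cons u us)
  have "F (u # us @ v # vs) = (-1) ^ length us * F (u # v # us @ vs)"
    using Cons.IH[OF alternating_Cons[OF Cons.prems]] .
  then show ?case
    using alternating_swap_front[OF Cons.prems, of u v "us @ vs"] by simp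
qed simp

lemma alternating_omit:
  assumes "alternating F" "i < length xs"
  shows "F xs = (-1) ^ i * F (xs ! i # omit i xs)"
  using alternating_move[OF assms(1), of "take i xs" "xs ! i" "drop (Suc i) xs"] assms(2)
  by (simp add: omit_def flip: id_take_nth_drop)

text \<open>Once the two equal entries stand side by side, swapping them changes only the sign, so
  the value is its own negative.\<close>

lemma alternating_not_distinct:
  assumes "alternating F" "\<not> distinct xs"
  shows "F xs = 0"
proof -
  obtain us vs ws y where xs: "xs = us @ [y] @ vs @ [y] @ ws"
    using not_distinct_decomp[OF assms(2)] by blast
  have "F (us @ y # vs @ y # ws) = (-1) ^ length vs * F (us @ y # y # vs @ ws)"
    using alternating_move[OF alternating_append[OF assms(1)], of "us @ [y]" vs y ws] by simp
  moreover have "F (us @ y # y # vs @ ws) = 0"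
    using alternating_swap[OF assms(1), of us y y "vs @ ws"] by simp
  ultimately show ?thesis
    unfolding xs by simp
qed

text \<open>Pulling the far entry next to the near one costs the same sign on both sides, so that a
  single adjacent swap remains.\<close>

lemma alternating_exchange:
  assumes "alternating F"
  shows "F (us @ a # ms @ b # vs) = - F (us @ b # ms @ a # vs)"
proof -
  have move: "F (us @ x # ms @ y # vs) = (-1) ^ length ms * F (us @ x # y # ms @ vs)" for x y
    using alternating_move[OF alternating_append[OF assms], of "us @ [x]" ms y vs] by simp
  show ?thesis
    unfolding move[of a b] move[of b a] alternating_swap[OF assms, of us a b] by simp
qed

section \<open>From adjacent swaps to arbitrary permutations\<close>

lemma permute_list_transpose:
  assumes "i < length xs" "j < length xs"
  shows "permute_list (transpose i j) xs = xs[i := xs ! j, j := xs ! i]"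
  using assms by (intro nth_equalityI) (auto simp: permute_list_def nth_list_update transpose_def)

lemma permute_list_transpose_append:
  "permute_list (transpose (length us) (Suc (length us + length ms))) (us @ a # ms @ b # vs)
    = us @ b # ms @ a # vs"
  by (subst permute_list_transpose) (simp_all add: nth_append list_update_append)

lemma alternating_transpose_less:
  assumes "alternating F" "i < j" "j < length xs"
  shows "F (permute_list (transpose i j) xs) = - F xs"
proof -
  have "i < length xs"
    using assms by simp
  then obtain us a ws where xs: "xs = us @ a # ws" and i: "i = length us"
    by (rule split_at_index) blast
  have "j - Suc i < length ws"
    using assms xs i by simp
  then obtain ms b vs where ws: "ws = ms @ b # vs" and "j - Suc i = length ms"
    by (rule split_at_index) blast
  then have "j = Suc (length us + length ms)"
    using assms i by simp
  then show ?thesis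
    using alternating_exchange[OF assms(1), of us a ms b vs]
    by (simp add: xs ws i permute_list_transpose_append)
qed

lemma alternating_transpose:
  assumes "alternating F" "i \<noteq> j" "i < length xs" "j < length xs"
  shows "F (permute_list (transpose i j) xs) = - F xs"
  using assms alternating_transpose_less[of F i j xs] alternating_transpose_less[of F j i xs]
  by (metis linorder_neqE_nat transpose_commute)

lemma alternating_permute:
  assumes "alternating F" "\<pi> permutes {..<length xs}"
  shows "F (permute_list \<pi> xs) = of_int (sign \<pi>) * F xs"
proof -
  \<comment> \<open>Quantified over the list, because the induction hypothesis is applied to the
    list already transposed by \<open>transpose a b\<close>.\<close>
  have perm: "\<forall>xs. length xs = n \<longrightarrow> F (permute_list \<pi> xs) = of_int (sign \<pi>) * F xs"
    if "\<pi> permutes {..<n}" for n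
    using that finite_lessThan
  proof (induction rule: permutes_induct)
    case (swap a b p)
    show ?case
    proof (intro allI impI)
      fix xs :: "'a list" assume len: "length xs = n"
      have p: "permutation p" "permutation (transpose a b)"
        using swap.hyps permutation_swap_id by (auto simp: permutation_permutes)
      have "F (permute_list (transpose a b \<circ> p) xs)
          = F (permute_list p (permute_list (transpose a b) xs))"
        using swap.hyps len by (simp add: permute_list_compose)
      also have "\<dots> = of_int (sign p) * F (permute_list (transpose a b) xs)"
        using swap.IH len by simp
      also have "\<dots> = - of_int (sign p) * F xs"
        using alternating_transpose[OF assms(1)] swap.hyps len by simp
      finally show "F (permute_list (transpose a b \<circ> p) xs)
          = of_int (sign (transpose a b \<circ> p)) * F xs"
        using swap.hyps p by (simp add: sign_compose sign_swap_id)
    qed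
  qed simp
  show ?thesis
    by (rule perm[rule_format, OF assms(2) refl])
qed

lemma alternating_from_permute:
  assumes "\<And>xs \<pi>. \<pi> permutes {..<length xs} \<Longrightarrow> F (permute_list \<pi> xs) = of_int (sign \<pi>) * F xs"
  shows "alternating F"
proof (rule alternatingI)
  fix us vs :: "'a list" and a b
  let ?i = "length us" and ?xs = "us @ a # b # vs"
  have perm: "transpose ?i (Suc ?i) permutes {..<length ?xs}"
    by (rule permutes_swap_id) auto
  have "permute_list (transpose ?i (Suc ?i)) ?xs = us @ b # a # vs"
    using permute_list_transpose_append[of us "[]" a b vs] by simp
  then show "F (us @ a # b # vs) = - F (us @ b # a # vs)"
    using assms[OF perm] by (simp add: sign_swap_id)
qed

text \<open>A permutation between the orderings changes both values by the same sign; hence one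
  ordering suffices, such as the sorted one.\<close>

lemma alternating_eqI:
  assumes F: "alternating F" and G: "alternating G"
    and eq: "F ys = G ys" and ms: "mset xs = mset ys"
  shows "F xs = G xs"
proof -
  obtain \<pi> where "\<pi> permutes {..<length ys}" "permute_list \<pi> ys = xs"
    using mset_eq_permutation[OF ms] by blast
  then show ?thesis
    using alternating_permute[OF F] alternating_permute[OF G] eq by metis
qed

section \<open>Identities between the difference and the average\<close>

lemma codiff_Nil [simp]: "codiff F [] = 0"
  by (simp add: codiff_def)

text \<open>Index 0 gives \<open>F xs\<close>, and shifting the other indices by one gives the minus
  sign. This recursion turns double sums over omitted entries into inductions on the list.\<close>

lemma codiff_Cons: "codiff F (x # xs) = F xs - codiff (\<lambda>ys. F (x # ys)) xs"
  unfolding codiff_def length_Cons sum.lessThan_Suc_shift by (simp add: sum_negf)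

lemma codiff_diff: "codiff (\<lambda>ys. F ys - G ys) xs = codiff F xs - codiff G xs"
  by (simp add: codiff_def right_diff_distrib sum_subtractf)

lemma codiff_minus: "codiff (\<lambda>ys. - F ys) xs = - codiff F xs"
  by (simp add: codiff_def sum_negf)

lemma codiff_cong: "(\<And>i. i < length xs \<Longrightarrow> F (omit i xs) = G (omit i xs)) \<Longrightarrow> codiff F xs = codiff G xs"
  by (simp add: codiff_def)

text \<open>By \<open>codiff_Cons\<close> two copies of \<open>codiff F xs\<close> cancel and the
  claim for \<open>\<lambda>ys. F (x # ys)\<close> is left; hence \<open>F\<close> is arbitrary in
  the induction.\<close>

lemma codiff_codiff: "codiff (codiff F) xs = 0"
proof (induction xs arbitrary: F)
  case (Cons x xs)
  then show ?case
    by (simp add: codiff_Cons codiff_diff)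
qed simp

lemma alternating_codiff:
  assumes "alternating F"
  shows "alternating (codiff F)"
proof (rule alternatingI)
  fix us vs :: "'a list" and a b
  show "codiff F (us @ a # b # vs) = - codiff F (us @ b # a # vs)"
    using assms
  proof (induction us arbitrary: F)
    case Nil
    \<comment> \<open>Two uses of \<open>codiff_Cons\<close> leave this tail and
      \<open>F (b # vs) - F (a # vs)\<close>, which is antisymmetric in \<open>a\<close> and
      \<open>b\<close> by itself.\<close>
    have "codiff (\<lambda>ys. F (a # b # ys)) vs = - codiff (\<lambda>ys. F (b # a # ys)) vs"
      unfolding codiff_minus[symmetric]
      by (rule codiff_cong) (rule alternating_swap_front[OF Nil])
    then show ?case
      by (simp add: codiff_Cons)
  next
    case (Cons u us)
    show ?case
      using Cons.IH[OF alternating_Cons[OF Cons.prems]] alternating_swap[OF Cons.prems, of us a b vs]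
      by (simp add: codiff_Cons)
  qed
qed

lemma avg_cong: "(\<And>v. v \<in> I \<Longrightarrow> F (v # xs) = G (v # xs)) \<Longrightarrow> avg I F xs = avg I G xs"
  by (simp add: avg_def)

lemma avg_minus: "avg I (\<lambda>ys. - F ys) xs = - avg I F xs"
  by (simp add: avg_def sum_negf)

lemma avg_diff: "avg I (\<lambda>ys. F ys - G ys) xs = avg I F xs - avg I G xs"
  by (simp add: avg_def sum_subtractf diff_divide_distrib)

lemma avg_zero: "(\<And>v. v \<in> I \<Longrightarrow> F (v # xs) = 0) \<Longrightarrow> avg I F xs = 0"
  by (simp add: avg_def)

text \<open>The average of \<open>codiff_Cons\<close> over the head \<open>v\<close>: the
  denominator cancels the \<open>card I\<close> copies of \<open>F xs\<close>.\<close>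

lemma codiff_avg:
  assumes "finite I" "I \<noteq> {}"
  shows "codiff (avg I F) xs = F xs - avg I (codiff F) xs"
proof -
  have "codiff (avg I F) xs = (\<Sum>v\<in>I. codiff (\<lambda>ys. F (v # ys)) xs) / real (card I)"
    unfolding codiff_def avg_def
    by (subst sum.swap) (simp add: sum_divide_distrib sum_distrib_left)
  moreover have "avg I (codiff F) xs = F xs - (\<Sum>v\<in>I. codiff (\<lambda>ys. F (v # ys)) xs) / real (card I)"
    using assms by (simp add: avg_def codiff_Cons sum_subtractf diff_divide_distrib)
  ultimately show ?thesis
    by simp
qed

text \<open>The double sum over \<open>I\<close> changes sign when its two variables are
  exchanged.\<close>

lemma avg_avg:
  assumes "alternating F"
  shows "avg I (avg I F) xs = 0"
proof -
  have "(\<Sum>v\<in>I. \<Sum>w\<in>I. F (w # v # xs)) = (\<Sum>v\<in>I. \<Sum>w\<in>I. - F (v # w # xs))"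
    using alternating_swap_front[OF assms] by (intro sum.cong refl)
  also have "\<dots> = - (\<Sum>w\<in>I. \<Sum>v\<in>I. F (v # w # xs))"
    by (subst sum.swap) (simp add: sum_negf)
  finally have "(\<Sum>v\<in>I. \<Sum>w\<in>I. F (w # v # xs)) = 0"
    by linarith
  then show ?thesis
    by (simp add: avg_def flip: sum_divide_distrib)
qed

section \<open>Oriented simplices\<close>

lemma oriented_simplex_eq_0:
  assumes "mset xs \<noteq> mset ys"
  shows "oriented_simplex xs ys = 0"
proof -
  have none: "{\<pi>. \<pi> permutes {..<length xs} \<and> permute_list \<pi> xs = ys} = {}"
    using assms by auto
  show ?thesis
    unfolding oriented_simplex_def none by simp
qed

text \<open>Only the identity permutation fixes a list without repetitions.\<close>

lemma oriented_simplex_self: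
  assumes "distinct xs"
  shows "oriented_simplex xs xs = 1"
proof -
  have "\<pi> = id" if \<pi>: "\<pi> permutes {..<length xs}" and eq: "permute_list \<pi> xs = xs" for \<pi>
  proof
    fix i
    show "\<pi> i = id i"
    proof (cases "i < length xs")
      case True
      then have "xs ! \<pi> i = xs ! i" "\<pi> i < length xs"
        using permute_list_nth[OF \<pi> True] eq permutes_in_image[OF \<pi>, of i] by auto
      then show ?thesis
        using assms True by (simp add: nth_eq_iff_index_eq)
    qed (use permutes_not_in[OF \<pi>] in simp)
  qed
  then have single: "{\<pi>. \<pi> permutes {..<length xs} \<and> permute_list \<pi> xs = xs} = {id}"
    by (auto simp: permutes_id)
  show ?thesis
    unfolding oriented_simplex_def single by simp
qed

lemma permute_list_inv:
  assumes "\<pi> permutes {..<length xs}"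
  shows "permute_list (inv \<pi>) (permute_list \<pi> xs) = xs"
    "permute_list \<pi> (permute_list (inv \<pi>) xs) = xs"
  using permute_list_compose[OF permutes_inv[OF assms], of \<pi>] permute_list_compose[OF assms, of "inv \<pi>"]
    permutes_inv_o[OF assms] by simp_all

text \<open>Inverting the permutation exchanges the two lists and keeps the sign. Alternation thus
  passes from one argument to the other.\<close>

lemma oriented_simplex_commute: "oriented_simplex xs ys = oriented_simplex ys xs"
proof (cases "length xs = length ys")
  case True
  have inv: "inv \<pi> permutes {..<length us}" "permute_list (inv \<pi>) vs = us"
      "inv (inv \<pi>) = \<pi>" "sign (inv \<pi>) = sign \<pi>"
    if "\<pi> permutes {..<length us}" "permute_list \<pi> us = vs" for \<pi> and us vs :: "'a list"
  proof -
    show "inv \<pi> permutes {..<length us}" "inv (inv \<pi>) = \<pi>"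
      using that(1) by (simp_all add: permutes_inv permutes_inv_inv)
    show "permute_list (inv \<pi>) vs = us"
      using permute_list_inv(1)[OF that(1)] that(2) by simp
    have "permutation \<pi>"
      using that(1) permutation_permutes by blast
    then show "sign (inv \<pi>) = sign \<pi>"
      by (rule sign_inverse)
  qed
  show ?thesis
    unfolding oriented_simplex_def
    by (rule sum.reindex_bij_witness[where i = inv and j = inv]) (use inv True in auto)
next
  case False
  then have "mset xs \<noteq> mset ys"
    by (metis mset_eq_length)
  then show ?thesis
    by (metis oriented_simplex_eq_0)
qed

text \<open>Composition with \<rho> is a bijection from the reorderings that lead to
  \<open>ys\<close> onto those that lead to \<open>permute_list \<rho> ys\<close>.\<close>

lemma oriented_simplex_permute:
  assumes \<rho>: "\<rho> permutes {..<length ys}"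
  shows "oriented_simplex xs (permute_list \<rho> ys) = of_int (sign \<rho>) * oriented_simplex xs ys"
proof (cases "length xs = length ys")
  case True
  have perm: "permutation \<pi>" if "\<pi> permutes {..<length ys}" for \<pi>
    using that permutation_permutes by blast
  show ?thesis
    unfolding oriented_simplex_def sum_distrib_left True
  proof (rule sum.reindex_bij_witness[where i = "\<lambda>\<sigma>. \<sigma> \<circ> \<rho>" and j = "\<lambda>\<pi>. \<pi> \<circ> inv \<rho>"])
    fix \<pi> assume "\<pi> \<in> {\<pi>. \<pi> permutes {..<length ys} \<and> permute_list \<pi> xs = permute_list \<rho> ys}"
    then have \<pi>: "\<pi> permutes {..<length ys}" and eq: "permute_list \<pi> xs = permute_list \<rho> ys"
      by auto
    show "\<pi> \<circ> inv \<rho> \<circ> \<rho> = \<pi>"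
      using permutes_inv_o[OF \<rho>] by (simp add: comp_assoc)
    show "\<pi> \<circ> inv \<rho> \<in> {\<pi>. \<pi> permutes {..<length ys} \<and> permute_list \<pi> xs = ys}"
      using permutes_compose[OF permutes_inv[OF \<rho>] \<pi>] permutes_inv[OF \<rho>] eq True
        permute_list_inv[OF \<rho>]
      by (simp add: permute_list_compose)
    show "real_of_int (sign \<rho>) * real_of_int (sign (\<pi> \<circ> inv \<rho>)) = real_of_int (sign \<pi>)"
      using sign_compose[OF perm[OF \<pi>] perm[OF permutes_inv[OF \<rho>]]] sign_inverse[OF perm[OF \<rho>]]
      by (simp flip: of_int_mult)
  next
    fix \<sigma> assume "\<sigma> \<in> {\<pi>. \<pi> permutes {..<length ys} \<and> permute_list \<pi> xs = ys}"
    then have \<sigma>: "\<sigma> permutes {..<length ys}" "permute_list \<sigma> xs = ys"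
      by auto
    show "\<sigma> \<circ> \<rho> \<circ> inv \<rho> = \<sigma>"
      using permutes_inv_o[OF \<rho>] by (simp add: comp_assoc)
    show "\<sigma> \<circ> \<rho> \<in> {\<pi>. \<pi> permutes {..<length ys} \<and> permute_list \<pi> xs = permute_list \<rho> ys}"
      using permutes_compose[OF \<rho> \<sigma>(1)] \<rho> \<sigma>(2) True by (simp add: permute_list_compose)
  qed
next
  case False
  then have "mset xs \<noteq> mset ys" "mset xs \<noteq> mset (permute_list \<rho> ys)"
    by (metis mset_eq_length length_permute_list)+
  then show ?thesis
    by (simp add: oriented_simplex_eq_0)
qed

lemma alternating_oriented_simplex: "alternating (oriented_simplex xs)"
  by (rule alternating_from_permute) (rule oriented_simplex_permute)

lemma alternating_oriented_simplex_left: "alternating (\<lambda>xs. oriented_simplex xs ys)"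
  unfolding oriented_simplex_commute[of _ ys] by (rule alternating_oriented_simplex)

lemma oriented_simplex_not_distinct:
  assumes "\<not> distinct xs"
  shows "oriented_simplex xs ys = 0" "oriented_simplex ys xs = 0"
  using alternating_not_distinct[OF alternating_oriented_simplex_left assms]
    alternating_not_distinct[OF alternating_oriented_simplex assms] by simp_all

lemma oriented_simplex_nonzeroD:
  assumes "oriented_simplex xs ys \<noteq> 0"
  shows "mset xs = mset ys" "distinct xs" "distinct ys" "set xs = set ys" "length xs = length ys"
proof -
  show "mset xs = mset ys"
    using assms oriented_simplex_eq_0 by blast
  then show "set xs = set ys" "length xs = length ys"
    by (metis set_mset_mset, metis size_mset)
  show "distinct xs" "distinct ys"
    using assms oriented_simplex_not_distinct by blast+
qed

text \<open>Both sides are alternating in \<open>xs\<close>, so it suffices to compare them at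
  \<open>xs = ys\<close>, where both are 1 or, with a repetition, 0.\<close>

lemma oriented_simplex_Cons:
  assumes "v \<notin> set ys"
  shows "oriented_simplex (v # xs) (v # ys) = oriented_simplex xs ys"
proof (cases "mset xs = mset ys")
  case True
  have "oriented_simplex (v # ys) (v # ys) = oriented_simplex ys ys"
    using assms by (cases "distinct ys") (simp_all add: oriented_simplex_self oriented_simplex_not_distinct)
  then show ?thesis
    using alternating_eqI[OF alternating_Cons[OF alternating_oriented_simplex_left]
        alternating_oriented_simplex_left _ True] by blast
qed (simp add: oriented_simplex_eq_0)

lemma oriented_simplex_map:
  assumes "inj f"
  shows "oriented_simplex (map f xs) (map f ys) = oriented_simplex xs ys"
proof -
  have "{\<pi>. \<pi> permutes {..<length xs} \<and> permute_list \<pi> (map f xs) = map f ys}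
      = {\<pi>. \<pi> permutes {..<length xs} \<and> permute_list \<pi> xs = ys}"
    using assms by (auto simp: permute_list_map inj_map_eq_map)
  then show ?thesis
    unfolding oriented_simplex_def by simp
qed

lemma finite_support_oriented_simplex: "finite {ys. oriented_simplex xs ys \<noteq> 0}"
proof (rule finite_subset)
  show "{ys. oriented_simplex xs ys \<noteq> 0} \<subseteq> (\<lambda>\<pi>. permute_list \<pi> xs) ` {\<pi>. \<pi> permutes {..<length xs}}"
  proof
    fix ys assume "ys \<in> {ys. oriented_simplex xs ys \<noteq> 0}"
    then obtain \<pi> where "\<pi> permutes {..<length xs}" "permute_list \<pi> xs = ys"
      unfolding oriented_simplex_def by (auto elim: sum.not_neutral_contains_not_neutral)
    then show "ys \<in> (\<lambda>\<pi>. permute_list \<pi> xs) ` {\<pi>. \<pi> permutes {..<length xs}}"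
      by blast
  qed
qed (simp add: finite_permutations)

text \<open>The permutations are grouped by the list they produce. \<open>S\<close> only has to
  cover the support of the product, so the support of \<open>H\<close> may serve if it is
  finite.\<close>

lemma sum_oriented_simplex:
  assumes "finite S" "{ys. oriented_simplex xs ys * H ys \<noteq> 0} \<subseteq> S"
  shows "(\<Sum>ys\<in>S. oriented_simplex xs ys * H ys)
    = (\<Sum>\<pi> | \<pi> permutes {..<length xs}. of_int (sign \<pi>) * H (permute_list \<pi> xs))"
proof -
  let ?P = "{\<pi>. \<pi> permutes {..<length xs}}"
  let ?T = "S \<union> (\<lambda>\<pi>. permute_list \<pi> xs) ` ?P"
  have fin: "finite ?P" "finite ?T"
    using assms(1) by (auto simp: finite_permutations)
  have "(\<Sum>ys\<in>S. oriented_simplex xs ys * H ys) = (\<Sum>ys\<in>?T. oriented_simplex xs ys * H ys)"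
    using fin assms(2) by (intro sum.mono_neutral_left) auto
  also have "\<dots> = (\<Sum>ys\<in>?T. \<Sum>\<pi> | \<pi> \<in> ?P \<and> permute_list \<pi> xs = ys. of_int (sign \<pi>) * H (permute_list \<pi> xs))"
    unfolding oriented_simplex_def sum_distrib_right by (intro sum.cong) auto
  also have "\<dots> = (\<Sum>\<pi>\<in>?P. of_int (sign \<pi>) * H (permute_list \<pi> xs))"
    by (rule sum.group[OF fin]) auto
  finally show ?thesis .
qed

text \<open>Each permutation contributes its sign twice, hence \<open>H xs\<close>. The resulting
  factorial cancels the division in \<open>boundary\<close>.\<close>

lemma sum_oriented_simplex_alternating:
  assumes "alternating H" "finite S" "{ys. oriented_simplex xs ys * H ys \<noteq> 0} \<subseteq> S"
  shows "(\<Sum>ys\<in>S. oriented_simplex xs ys * H ys) = fact (length xs) * H xs"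
proof -
  have "(\<Sum>ys\<in>S. oriented_simplex xs ys * H ys) = (\<Sum>\<pi> | \<pi> permutes {..<length xs}. H xs)"
    unfolding sum_oriented_simplex[OF assms(2,3)]
    by (intro sum.cong refl)
      (simp add: alternating_permute[OF assms(1)] flip: of_int_mult mult.assoc)
  then show ?thesis
    by (simp add: card_permutations)
qed

section \<open>Chains and cochains\<close>

text \<open>Excluding the empty set ensures that there are no nonzero chains in degree -1.\<close>

definition is_complex :: "'v set set \<Rightarrow> bool" where
  "is_complex X \<longleftrightarrow> {} \<notin> X \<and> (\<forall>s\<in>X. \<forall>t. t \<subseteq> s \<and> t \<noteq> {} \<longrightarrow> t \<in> X)"

definition simplex :: "'v set set \<Rightarrow> int \<Rightarrow> 'v list \<Rightarrow> bool" where
  "simplex X q xs \<longleftrightarrow> distinct xs \<and> set xs \<in> X \<and> int (length xs) = q + 1"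

text \<open>Total in the list: for a cochain it vanishes off the simplices of its degree, thanks to
  the extension by zero.\<close>

definition coef :: "'v cochain \<Rightarrow> 'v list \<Rightarrow> real" where
  "coef \<alpha> xs = \<alpha> (oriented_simplex xs)"

lemma chains_support: "c \<in> chains X q \<Longrightarrow> finite {xs. c xs \<noteq> 0}"
  unfolding chains_def by blast

lemma chains_simplex: "c \<in> chains X q \<Longrightarrow> c xs \<noteq> 0 \<Longrightarrow> simplex X q xs"
  unfolding chains_def simplex_def by blast

lemma alternating_chain: "c \<in> chains X q \<Longrightarrow> alternating c"
  by (rule alternating_from_permute) (auto simp: chains_def)

lemma chains_zero: "(\<lambda>xs. 0) \<in> chains X q"
  by (simp add: chains_def)

lemma chains_lincomb:
  assumes "b \<in> chains X q" "c \<in> chains X q"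
  shows "(\<lambda>xs. r * b xs + s * c xs) \<in> chains X q"
proof -
  have "finite {xs. r * b xs + s * c xs \<noteq> 0}"
    by (rule finite_subset[OF _ finite_UnI[OF chains_support[OF assms(1)] chains_support[OF assms(2)]]]) auto
  moreover have "simplex X q xs" if "r * b xs + s * c xs \<noteq> 0" for xs
    using that chains_simplex[OF assms(1), of xs] chains_simplex[OF assms(2), of xs]
    by (cases "b xs = 0") auto
  moreover have "b (permute_list \<pi> xs) = of_int (sign \<pi>) * b xs"
      "c (permute_list \<pi> xs) = of_int (sign \<pi>) * c xs" if "\<pi> permutes {..<length xs}" for \<pi> xs
    using that assms by (auto simp: chains_def)
  ultimately show ?thesis
    by (simp add: chains_def simplex_def algebra_simps)
qed

lemma chains_sum:
  assumes "finite S" "\<And>s. s \<in> S \<Longrightarrow> f s \<in> chains X q"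
  shows "(\<lambda>xs. \<Sum>s\<in>S. r s * f s xs) \<in> chains X q"
  using assms
proof (induction S rule: finite_induct)
  case (insert s S)
  then show ?case
    using chains_lincomb[of "f s" X q "\<lambda>xs. \<Sum>s\<in>S. r s * f s xs" "r s" 1] by simp
qed (simp add: chains_zero)

lemma oriented_simplex_chain:
  assumes "simplex X q xs"
  shows "oriented_simplex xs \<in> chains X q"
  using assms oriented_simplex_nonzeroD(3-5)[of xs]
  by (auto simp: chains_def finite_support_oriented_simplex oriented_simplex_permute simplex_def)

lemma cochain_lincomb:
  assumes "\<alpha> \<in> cochains X q" "b \<in> chains X q" "c \<in> chains X q"
  shows "\<alpha> (\<lambda>xs. r * b xs + s * c xs) = r * \<alpha> b + s * \<alpha> c"
  using assms unfolding cochains_def by blast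

lemma cochain_outside: "\<alpha> \<in> cochains X q \<Longrightarrow> c \<notin> chains X q \<Longrightarrow> \<alpha> c = 0"
  unfolding cochains_def by blast

lemma cochain_zero:
  assumes "\<alpha> \<in> cochains X q"
  shows "\<alpha> (\<lambda>xs. 0) = 0"
  using cochain_lincomb[OF assms chains_zero chains_zero, of 0 0] by simp

lemma cochain_sum:
  assumes "\<alpha> \<in> cochains X q" "finite S" "\<And>s. s \<in> S \<Longrightarrow> f s \<in> chains X q"
  shows "\<alpha> (\<lambda>xs. \<Sum>s\<in>S. r s * f s xs) = (\<Sum>s\<in>S. r s * \<alpha> (f s))"
  using assms(2,3)
proof (induction S rule: finite_induct)
  case empty
  show ?case
    using cochain_zero[OF assms(1)] by simp
next
  case (insert s S)
  then show ?case
    using cochain_lincomb[OF assms(1), of "f s" "\<lambda>xs. \<Sum>s\<in>S. r s * f s xs" "r s" 1]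
      chains_sum[of S f X q r] by simp
qed

lemma alternating_coef:
  assumes "\<alpha> \<in> cochains X q"
  shows "alternating (coef \<alpha>)"
proof (rule alternatingI)
  fix us vs :: "'a list" and a b
  let ?xs = "us @ a # b # vs" and ?ys = "us @ b # a # vs"
  have eq: "oriented_simplex ?xs = (\<lambda>zs. (-1) * oriented_simplex ?ys zs + 0 * oriented_simplex ?ys zs)"
      "oriented_simplex ?ys = (\<lambda>zs. (-1) * oriented_simplex ?xs zs + 0 * oriented_simplex ?xs zs)"
    using alternating_swap[OF alternating_oriented_simplex_left, of us a b vs] by auto
  show "coef \<alpha> ?xs = - coef \<alpha> ?ys"
  proof (cases "oriented_simplex ?ys \<in> chains X q")
    case True
    then show ?thesis
      unfolding coef_def using cochain_lincomb[OF assms True True, of "-1" 0] eq(1) by simp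
  next
    case False
    \<comment> \<open>Chains are closed under negation, so neither of the two is a chain and both
      coefficients are 0.\<close>
    have "oriented_simplex ?xs \<notin> chains X q"
    proof
      assume xs: "oriented_simplex ?xs \<in> chains X q"
      show False
        using chains_lincomb[OF xs xs, of "-1" 0] False unfolding eq(2)[symmetric] by contradiction
    qed
    then show ?thesis
      using False cochain_outside[OF assms] by (simp add: coef_def)
  qed
qed

text \<open>Without repetitions the elementary chain has the value 1 at \<open>xs\<close>, so it
  lies in \<open>chains X q\<close> only if \<open>xs\<close> is a simplex; elsewhere \<alpha> is
  0.\<close>

lemma coef_not_simplex:
  assumes "\<alpha> \<in> cochains X q" "\<not> simplex X q xs"
  shows "coef \<alpha> xs = 0"
proof (cases "distinct xs")
  case True
  then have "oriented_simplex xs \<notin> chains X q"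
    using chains_simplex[of "oriented_simplex xs" X q xs] oriented_simplex_self[of xs] assms(2) by auto
  then show ?thesis
    using cochain_outside[OF assms(1)] by (simp add: coef_def)
qed (rule alternating_not_distinct[OF alternating_coef[OF assms(1)]])

lemma chain_expansion:
  assumes "c \<in> chains X q"
  shows "c = (\<lambda>ys. \<Sum>xs | c xs \<noteq> 0. c xs / fact (length xs) * oriented_simplex xs ys)"
proof
  fix ys
  \<comment> \<open>The arguments of \<open>oriented_simplex\<close> are exchanged so that the sum
    formula for alternating functions applies to \<open>c\<close>; the factorials agree because
    nonzero terms have equal lengths.\<close>
  have "(\<Sum>xs | c xs \<noteq> 0. c xs / fact (length xs) * oriented_simplex xs ys)
      = (\<Sum>xs | c xs \<noteq> 0. oriented_simplex ys xs * c xs) / fact (length ys)"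
    unfolding sum_divide_distrib
    by (intro sum.cong refl)
      (metis (no_types, lifting) mult.commute mult_zero_left mult_zero_right div_by_0 divide_eq_0_iff
        oriented_simplex_commute oriented_simplex_nonzeroD(5) times_divide_eq_left)
  also have "\<dots> = c ys"
    by (subst sum_oriented_simplex_alternating[OF alternating_chain[OF assms] chains_support[OF assms]])
      auto
  finally show "c ys = (\<Sum>xs | c xs \<noteq> 0. c xs / fact (length xs) * oriented_simplex xs ys)" ..
qed

lemma cochain_expansion:
  assumes "\<alpha> \<in> cochains X q" "c \<in> chains X q"
  shows "\<alpha> c = (\<Sum>xs | c xs \<noteq> 0. c xs / fact (length xs) * coef \<alpha> xs)"
proof -
  have "\<alpha> (\<lambda>ys. \<Sum>xs | c xs \<noteq> 0. c xs / fact (length xs) * oriented_simplex xs ys)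
      = (\<Sum>xs | c xs \<noteq> 0. c xs / fact (length xs) * coef \<alpha> xs)"
    unfolding coef_def
    using chains_simplex[OF assms(2)]
    by (intro cochain_sum[OF assms(1) chains_support[OF assms(2)]] oriented_simplex_chain) blast
  then show ?thesis
    using chain_expansion[OF assms(2)] by simp
qed

lemma cochain_eqI:
  assumes "\<alpha> \<in> cochains X q" "\<beta> \<in> cochains X q"
    and "\<And>xs. simplex X q xs \<Longrightarrow> coef \<alpha> xs = coef \<beta> xs"
  shows "\<alpha> = \<beta>"
proof
  fix c
  show "\<alpha> c = \<beta> c"
  proof (cases "c \<in> chains X q")
    case True
    then show ?thesis
      unfolding cochain_expansion[OF assms(1) True] cochain_expansion[OF assms(2) True]
      by (intro sum.cong) (auto simp: assms(3) chains_simplex)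
  qed (simp add: cochain_outside[OF assms(1)] cochain_outside[OF assms(2)])
qed

lemma cochains_lincomb:
  assumes "\<alpha> \<in> cochains X q" "\<beta> \<in> cochains X q"
  shows "(\<lambda>c. r * \<alpha> c + s * \<beta> c) \<in> cochains X q"
  using assms by (simp add: cochains_def algebra_simps)

lemma cochains_zero: "(\<lambda>c. 0) \<in> cochains X q"
  by (simp add: cochains_def)

lemma cochains_add:
  "\<alpha> \<in> cochains X q \<Longrightarrow> \<beta> \<in> cochains X q \<Longrightarrow> (\<lambda>c. \<alpha> c + \<beta> c) \<in> cochains X q"
  using cochains_lincomb[of \<alpha> X q \<beta> 1 1] by simp

lemma cochains_diff:
  "\<alpha> \<in> cochains X q \<Longrightarrow> \<beta> \<in> cochains X q \<Longrightarrow> (\<lambda>c. \<alpha> c - \<beta> c) \<in> cochains X q"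
  using cochains_lincomb[of \<alpha> X q \<beta> 1 "-1"] by simp

lemma cochains_scale: "\<alpha> \<in> cochains X q \<Longrightarrow> (\<lambda>c. r * \<alpha> c) \<in> cochains X q"
  using cochains_lincomb[of \<alpha> X q \<alpha> r 0] by simp

lemma cochains_sum:
  "(\<And>s. s \<in> S \<Longrightarrow> f s \<in> cochains X q) \<Longrightarrow> (\<lambda>c. \<Sum>s\<in>S. f s c) \<in> cochains X q"
  by (induction S rule: infinite_finite_induct) (simp_all add: cochains_zero cochains_add)

lemma dual_cochain_in_cochains: "dual_cochain X q xs \<in> cochains X q"
  by (simp add: cochains_def dual_cochain_def chains_lincomb)

section \<open>The coboundary in coefficients\<close>

lemma simplex_omit:
  assumes "is_complex X" "simplex X (q + 1) xs" "2 \<le> length xs" "i < length xs"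
  shows "simplex X q (omit i xs)"
proof -
  have "length (omit i xs) \<noteq> 0"
    using assms(3,4) by (simp add: length_omit)
  then have "set (omit i xs) \<noteq> {}"
    by auto
  moreover have "set (omit i xs) \<subseteq> set xs"
    using assms(2,4) set_omit[of xs i] by (auto simp: simplex_def)
  ultimately have "set (omit i xs) \<in> X"
    using assms(1,2) by (auto simp: simplex_def is_complex_def)
  then show ?thesis
    using assms by (auto simp: simplex_def distinct_omit length_omit)
qed

lemma simplex_boundary_chain:
  assumes "is_complex X" "simplex X (q + 1) xs"
  shows "simplex_boundary xs \<in> chains X q"
proof (cases "length xs \<le> 1")
  case False
  then show ?thesis
    unfolding simplex_boundary_def using assms
    by (auto intro!: chains_sum oriented_simplex_chain simplex_omit)
qed (simp add: simplex_boundary_def chains_zero)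

lemma cochain_simplex_boundary:
  assumes "is_complex X" "\<alpha> \<in> cochains X q" "simplex X (q + 1) xs"
  shows "\<alpha> (simplex_boundary xs) = codiff (coef \<alpha>) xs"
proof (cases "length xs \<le> 1")
  case True
  \<comment> \<open>At a vertex \<open>codiff\<close> yields the augmentation term
    \<open>coef \<alpha> []\<close>, which \<open>simplex_boundary\<close> lacks; it is 0 since the
    empty list is no simplex.\<close>
  have "coef \<alpha> [] = 0"
    using assms(1) by (intro coef_not_simplex[OF assms(2)]) (auto simp: simplex_def is_complex_def)
  moreover have "omit i xs = []" if "i < length xs" for i
    using True that length_omit[OF that] by simp
  ultimately have "codiff (coef \<alpha>) xs = 0"
    by (simp add: codiff_def)
  then show ?thesis
    using True cochain_zero[OF assms(2)] by (simp add: simplex_boundary_def)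
next
  case False
  then have chain: "oriented_simplex (omit i xs) \<in> chains X q" if "i < length xs" for i
    using that assms by (intro oriented_simplex_chain simplex_omit) auto
  show ?thesis
    using False cochain_sum[OF assms(2), of "{..<length xs}" "\<lambda>i. oriented_simplex (omit i xs)"] chain
    by (simp add: simplex_boundary_def codiff_def coef_def)
qed

lemma boundary_chain:
  assumes "is_complex X" "c \<in> chains X (q + 1)"
  shows "boundary c \<in> chains X q"
  unfolding boundary_def
  using assms(1) chains_simplex[OF assms(2)]
  by (intro chains_sum chains_support[OF assms(2)] simplex_boundary_chain) auto

lemma boundary_superset:
  assumes "finite S" "{xs. c xs \<noteq> 0} \<subseteq> S"
  shows "boundary c ys = (\<Sum>xs\<in>S. c xs / fact (length xs) * simplex_boundary xs ys)"
  unfolding boundary_def using assms by (intro sum.mono_neutral_left) auto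

lemma boundary_lincomb:
  assumes "b \<in> chains X q" "c \<in> chains X q"
  shows "boundary (\<lambda>xs. r * b xs + s * c xs) = (\<lambda>ys. r * boundary b ys + s * boundary c ys)"
proof
  fix ys
  let ?S = "{xs. b xs \<noteq> 0} \<union> {xs. c xs \<noteq> 0}"
  have fin: "finite ?S"
    using assms chains_support by blast
  have "boundary (\<lambda>xs. r * b xs + s * c xs) ys
      = (\<Sum>xs\<in>?S. (r * b xs + s * c xs) / fact (length xs) * simplex_boundary xs ys)"
    using fin by (rule boundary_superset) auto
  also have "\<dots> = r * (\<Sum>xs\<in>?S. b xs / fact (length xs) * simplex_boundary xs ys)
      + s * (\<Sum>xs\<in>?S. c xs / fact (length xs) * simplex_boundary xs ys)"
    by (simp add: sum_distrib_left sum.distrib[symmetric] add_divide_distrib distrib_right mult.assoc)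
  also have "\<dots> = r * boundary b ys + s * boundary c ys"
    using boundary_superset[OF fin, of b ys] boundary_superset[OF fin, of c ys] by simp
  finally show "boundary (\<lambda>xs. r * b xs + s * c xs) ys = r * boundary b ys + s * boundary c ys" .
qed

lemma coboundary_cochain:
  assumes "is_complex X" "\<alpha> \<in> cochains X q"
  shows "coboundary X q \<alpha> \<in> cochains X (q + 1)"
  unfolding cochains_def coboundary_def
  using cochain_lincomb[OF assms(2)] boundary_chain[OF assms(1)]
  by (simp add: chains_lincomb boundary_lincomb)

text \<open>\<open>boundary\<close> runs over all orderings of \<open>xs\<close>; since
  \<open>codiff (coef \<alpha>)\<close> is alternating they contribute equally, and the factorial
  cancels.\<close>

lemma coef_coboundary:
  assumes "is_complex X" "\<alpha> \<in> cochains X q" "simplex X (q + 1) xs"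
  shows "coef (coboundary X q \<alpha>) xs = codiff (coef \<alpha>) xs"
proof -
  let ?S = "{ys. oriented_simplex xs ys \<noteq> 0}"
  have simplex: "simplex X (q + 1) ys" if "ys \<in> ?S" for ys
    using that chains_simplex[OF oriented_simplex_chain[OF assms(3)]] by blast
  have "coef (coboundary X q \<alpha>) xs = \<alpha> (boundary (oriented_simplex xs))"
    using oriented_simplex_chain[OF assms(3)] by (simp add: coef_def coboundary_def)
  also have "\<dots> = (\<Sum>ys\<in>?S. oriented_simplex xs ys / fact (length ys) * \<alpha> (simplex_boundary ys))"
    unfolding boundary_def
    by (rule cochain_sum[OF assms(2) finite_support_oriented_simplex])
      (rule simplex_boundary_chain[OF assms(1) simplex])
  also have "\<dots> = (\<Sum>ys\<in>?S. oriented_simplex xs ys * codiff (coef \<alpha>) ys / fact (length xs))"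
    using oriented_simplex_nonzeroD(5)[of xs]
    by (intro sum.cong refl) (simp add: cochain_simplex_boundary[OF assms(1,2) simplex])
  also have "\<dots> = codiff (coef \<alpha>) xs"
    unfolding sum_divide_distrib[symmetric]
    by (subst sum_oriented_simplex_alternating[OF alternating_codiff[OF alternating_coef[OF assms(2)]]
          finite_support_oriented_simplex]) auto
  finally show ?thesis .
qed

text \<open>Frees the formula from degree and distinctness: in a wrong degree all omitted lists have
  the wrong length, and with a repetition both sides vanish by alternation. The premise excludes
  missing faces, where \<open>codiff\<close> can be nonzero although the coefficient is 0.\<close>

lemma coef_coboundary_not_degenerate:
  assumes "is_complex X" "\<alpha> \<in> cochains X q" "distinct xs \<Longrightarrow> xs \<noteq> [] \<Longrightarrow> set xs \<in> X"
  shows "coef (coboundary X q \<alpha>) xs = codiff (coef \<alpha>) xs"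
proof (cases "simplex X (q + 1) xs")
  case False
  have "codiff (coef \<alpha>) xs = 0"
  proof (cases "distinct xs \<and> xs \<noteq> []")
    case True
    then have "int (length xs) \<noteq> q + 2"
      using False assms(3) by (simp add: simplex_def)
    then have "coef \<alpha> (omit i xs) = 0" if "i < length xs" for i
      using that length_omit[OF that] by (intro coef_not_simplex[OF assms(2)]) (auto simp: simplex_def)
    then show ?thesis
      by (simp add: codiff_def)
  next
    case False
    then show ?thesis
      using alternating_not_distinct[OF alternating_codiff[OF alternating_coef[OF assms(2)]]] by auto
  qed
  then show ?thesis
    using coef_not_simplex[OF coboundary_cochain[OF assms(1,2)] False] by simp
qed (rule coef_coboundary[OF assms(1,2)])

section \<open>Coefficients of the welding maps\<close>

text \<open>Translates the prescribed sum over positions of a face into prepending a vertex: only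
  vertices of \<open>ys\<close> contribute, and bringing \<open>ys ! i\<close> to the front costs
  \<open>(-1) ^ i\<close>.\<close>

lemma sum_vertex_oriented_simplex:
  assumes "finite I" "distinct ys"
  shows "(\<Sum>v\<in>I. oriented_simplex (v # xs) ys)
    = (\<Sum>i | i < length ys \<and> ys ! i \<in> I. (-1) ^ i * oriented_simplex xs (omit i ys))"
proof -
  have "(\<Sum>v\<in>I. oriented_simplex (v # xs) ys) = (\<Sum>v\<in>I \<inter> set ys. oriented_simplex (v # xs) ys)"
  proof (rule sum.mono_neutral_right)
    show "\<forall>v\<in>I - I \<inter> set ys. oriented_simplex (v # xs) ys = 0"
      using oriented_simplex_nonzeroD(4)[of "_ # xs" ys] by fastforce
  qed (use assms in auto)
  also have "\<dots> = (\<Sum>i | i < length ys \<and> ys ! i \<in> I. oriented_simplex (ys ! i # xs) ys)"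
  proof (rule sum.reindex_bij_betw[symmetric])
    show "bij_betw ((!) ys) {i. i < length ys \<and> ys ! i \<in> I} (I \<inter> set ys)"
      using assms(2) by (auto simp: bij_betw_def inj_on_def nth_eq_iff_index_eq in_set_conv_nth)
  qed
  also have "\<dots> = (\<Sum>i | i < length ys \<and> ys ! i \<in> I. (-1) ^ i * oriented_simplex xs (omit i ys))"
  proof (intro sum.cong refl)
    fix i assume "i \<in> {i. i < length ys \<and> ys ! i \<in> I}"
    then have i: "i < length ys" by simp
    show "oriented_simplex (ys ! i # xs) ys = (-1) ^ i * oriented_simplex xs (omit i ys)"
      unfolding alternating_omit[OF alternating_oriented_simplex i]
      using set_omit[OF assms(2) i] by (subst oriented_simplex_Cons) auto
  qed
  finally show ?thesis .
qed

text \<open>Only \<open>J = set xs\<close> can contribute. With its sorted list kept fixed, the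
  product is alternating in \<open>xs\<close> and agrees with \<open>F\<close> at the sorted list.
  This carries the linear extensions, given on sorted faces, over to all lists.\<close>

lemma sum_faces:
  fixes xs :: "nat list"
  assumes "alternating F" "set xs \<subseteq> {0..n}" "int (length xs) = q + 1"
  shows "(\<Sum>J | J \<in> faces n q \<and> P J. F (sorted_list_of_set J) * oriented_simplex xs (sorted_list_of_set J))
    = (if P (set xs) then F xs else 0)"
proof -
  let ?f = "\<lambda>J. F (sorted_list_of_set J) * oriented_simplex xs (sorted_list_of_set J)"
  have fin: "finite J" if "J \<in> faces n q" for J
    using that finite_subset[of J "{0..n}"] by (auto simp: faces_def)
  have zero: "?f J = 0" if "J \<in> faces n q" "J \<noteq> set xs" for J
    using oriented_simplex_nonzeroD(4)[of xs "sorted_list_of_set J"] that fin by auto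
  have finP: "finite {J. J \<in> faces n q \<and> P J}"
    by (rule finite_subset[of _ "Pow {0..n}"]) (auto simp: faces_def)
  show ?thesis
  proof (cases "P (set xs) \<and> distinct xs")
    case True
    then have mem: "set xs \<in> {J. J \<in> faces n q \<and> P J}"
      using assms by (simp add: faces_def distinct_card)
    have rest: "sum ?f ({J. J \<in> faces n q \<and> P J} - {set xs}) = 0"
      by (rule sum.neutral) (use zero in blast)
    have "(\<Sum>J | J \<in> faces n q \<and> P J. ?f J) = ?f (set xs)"
      by (rule trans[OF sum.remove[OF finP mem]]) (simp only: rest add_0_right)
    also have "\<dots> = F xs"
    proof -
      let ?ys = "sorted_list_of_set (set xs)"
      have alt: "alternating (\<lambda>xs. F ?ys * oriented_simplex xs ?ys)"
        by (intro alternating_scale alternating_oriented_simplex_left)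
      have mset: "mset xs = mset ?ys"
        using True by (subst set_eq_iff_mset_eq_distinct[symmetric]) simp_all
      have self: "F ?ys * oriented_simplex ?ys ?ys = F ?ys"
        by (simp add: oriented_simplex_self)
      show ?thesis
        by (rule alternating_eqI[OF alt assms(1) self mset])
    qed
    finally show ?thesis
      using True by simp
  next
    case False
    have "?f J = 0" if "J \<in> faces n q" "P J" for J
    proof (cases "distinct xs")
      case True
      then show ?thesis
        using False that zero by blast
    qed (simp add: oriented_simplex_not_distinct)
    then have "(\<Sum>J | J \<in> faces n q \<and> P J. ?f J) = 0"
      by (intro sum.neutral) auto
    then show ?thesis
      using False alternating_not_distinct[OF assms(1)] by auto
  qed
qed

lemma inj_E: "inj E"
  by (simp add: inj_on_def)

lemma dual_cochain_oriented_simplex: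
  "simplex X q xs \<Longrightarrow> dual_cochain X q ys (oriented_simplex xs) = oriented_simplex xs ys"
  by (simp add: dual_cochain_def oriented_simplex_chain)

lemma oriented_simplex_E_Star [simp]:
  "oriented_simplex (map E xs) (Star # ys) = 0"
  "oriented_simplex (Star # ys) (map E xs) = 0"
proof -
  have "set (map E xs) \<noteq> set (Star # ys)"
    by auto
  then show "oriented_simplex (map E xs) (Star # ys) = 0" "oriented_simplex (Star # ys) (map E xs) = 0"
    using oriented_simplex_nonzeroD(4)[of "map E xs" "Star # ys"]
      oriented_simplex_nonzeroD(4)[of "Star # ys" "map E xs"] by auto
qed

lemma oriented_simplex_Star_Star [simp]:
  "oriented_simplex (Star # map E xs) (Star # map E ys) = oriented_simplex xs ys"
  by (subst oriented_simplex_Cons) (auto simp: oriented_simplex_map[OF inj_E])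

lemma oriented_simplex_E [simp]: "oriented_simplex (map E xs) (map E ys) = oriented_simplex xs ys"
  by (rule oriented_simplex_map[OF inj_E])

lemma simplex_simplex_complex:
  "simplex (simplex_complex n) q (map E xs) \<longleftrightarrow>
    distinct xs \<and> set xs \<subseteq> {0..n} \<and> xs \<noteq> [] \<and> int (length xs) = q + 1"
  by (auto simp: simplex_def simplex_complex_def distinct_map inj_on_def inj_image_eq_iff[OF inj_E])

lemma map_E_exists: "Star \<notin> set zs \<Longrightarrow> \<exists>xs. zs = map E xs"
  by (induction zs) (auto, metis list.simps(9) vertex.exhaust)

lemma is_complex_simplex_complex: "is_complex (simplex_complex n)"
  unfolding is_complex_def
proof (intro conjI ballI allI impI)
  fix s t assume "s \<in> simplex_complex n" "t \<subseteq> s \<and> t \<noteq> {}"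
  then obtain J K where "J \<subseteq> {0..n}" "K \<subseteq> J" "t = E ` K" "K \<noteq> {}"
    unfolding simplex_complex_def by (auto elim!: subset_imageE)
  then show "t \<in> simplex_complex n"
    unfolding simplex_complex_def by blast
qed (simp add: simplex_complex_def)

section \<open>The two kinds of simplices of the subdivision\<close>

locale stellar =
  fixes n :: nat and I :: "nat set"
  assumes I_subset: "I \<subseteq> {0..n}" and I_nonempty: "I \<noteq> {}"
begin

abbreviation "X \<equiv> stellar_subdivision n I"
abbreviation "D \<equiv> simplex_complex n"

lemma finite_I: "finite I"
  using I_subset finite_subset by blast

lemma E_image_in_X: "E ` J \<in> X \<longleftrightarrow> J \<subseteq> {0..n} \<and> J \<noteq> {} \<and> \<not> I \<subseteq> J"
  by (auto simp: stellar_subdivision_def inj_image_eq_iff[OF inj_E])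

lemma insert_Star_in_X: "insert Star (E ` J) \<in> X \<longleftrightarrow> J \<subseteq> {0..n} \<and> \<not> I \<subseteq> J"
proof -
  have "insert Star (E ` J) = insert Star (E ` K) \<longleftrightarrow> J = K" for K
    by auto
  moreover have "insert Star (E ` J) \<noteq> E ` K" for K
    by auto
  ultimately show ?thesis
    by (auto simp: stellar_subdivision_def)
qed

lemma simplex_E:
  "simplex X q (map E xs) \<longleftrightarrow>
    distinct xs \<and> set xs \<subseteq> {0..n} \<and> xs \<noteq> [] \<and> \<not> I \<subseteq> set xs \<and> int (length xs) = q + 1"
  by (auto simp: simplex_def E_image_in_X distinct_map inj_on_def)

lemma simplex_Star:
  "simplex X q (Star # map E xs) \<longleftrightarrow>
    distinct xs \<and> set xs \<subseteq> {0..n} \<and> \<not> I \<subseteq> set xs \<and> int (length xs) = q"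
  by (auto simp: simplex_def insert_Star_in_X distinct_map inj_on_def)

lemma is_complex_X: "is_complex X"
proof -
  have "t \<in> X" if st: "s \<in> X" "t \<subseteq> s" "t \<noteq> {}" for s t
  proof -
    obtain J where J: "J \<subseteq> {0..n}" "\<not> I \<subseteq> J" and s: "s = E ` J \<or> s = insert Star (E ` J)"
      using st(1) by (auto simp: stellar_subdivision_def)
    \<comment> \<open>The index set of \<open>t\<close> lies in \<open>J\<close>, so it misses a
      vertex of \<open>I\<close> as well; it is empty if \<open>t\<close> is the vertex
      \<open>Star\<close>.\<close>
    define K where "K = {j. E j \<in> t}"
    have "K \<subseteq> J"
      using s st(2) by (auto simp: K_def)
    then have K: "K \<subseteq> {0..n}" "\<not> I \<subseteq> K"
      using J(1,2) by blast+
    have mem: "x \<in> t \<longleftrightarrow> x = Star \<and> Star \<in> t \<or> x \<in> E ` K" for x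
      by (cases x) (auto simp: K_def)
    show ?thesis
    proof (cases "Star \<in> t")
      case True
      then have "t = insert Star (E ` K)"
        using mem by blast
      then show ?thesis
        using K insert_Star_in_X by simp
    next
      case False
      then have "t = E ` K"
        using mem by blast
      then show ?thesis
        using K st(3) E_image_in_X by simp
    qed
  qed
  moreover have "{} \<notin> X"
    by (auto simp: stellar_subdivision_def)
  ultimately show ?thesis
    unfolding is_complex_def by blast
qed

lemma simplex_complex_cochain_eqI:
  assumes "\<alpha> \<in> cochains D q" "\<beta> \<in> cochains D q"
    and "\<And>xs. distinct xs \<Longrightarrow> set xs \<subseteq> {0..n} \<Longrightarrow> coef \<alpha> (map E xs) = coef \<beta> (map E xs)"
  shows "\<alpha> = \<beta>"
proof (rule cochain_eqI[OF assms(1,2)])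
  fix zs assume "simplex D q zs"
  moreover from this obtain xs where "zs = map E xs"
    using map_E_exists[of zs] by (auto simp: simplex_def simplex_complex_def)
  ultimately show "coef \<alpha> zs = coef \<beta> zs"
    using assms(3) by (auto simp: simplex_simplex_complex)
qed

text \<open>\<open>Star\<close> occurs at most once in a simplex, and moving it to the front costs
  both coefficients the same sign.\<close>

lemma stellar_cochain_eqI:
  assumes "\<alpha> \<in> cochains X q" "\<beta> \<in> cochains X q"
    and E: "\<And>xs. distinct xs \<Longrightarrow> set xs \<subseteq> {0..n} \<Longrightarrow> \<not> I \<subseteq> set xs \<Longrightarrow>
      coef \<alpha> (map E xs) = coef \<beta> (map E xs)"
    and Star: "\<And>xs. distinct xs \<Longrightarrow> set xs \<subseteq> {0..n} \<Longrightarrow> \<not> I \<subseteq> set xs \<Longrightarrow>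
      coef \<alpha> (Star # map E xs) = coef \<beta> (Star # map E xs)"
  shows "\<alpha> = \<beta>"
proof (rule cochain_eqI[OF assms(1,2)])
  fix zs assume zs: "simplex X q zs"
  show "coef \<alpha> zs = coef \<beta> zs"
  proof (cases "Star \<in> set zs")
    case True
    then obtain us vs where split: "zs = us @ Star # vs"
      by (meson split_list)
    then have "Star \<notin> set (us @ vs)"
      using zs by (auto simp: simplex_def)
    then obtain xs where xs: "us @ vs = map E xs"
      using map_E_exists by blast
    have "simplex X q (Star # map E xs)"
      using zs unfolding split xs[symmetric] by (auto simp: simplex_def)
    then have "coef \<alpha> (Star # us @ vs) = coef \<beta> (Star # us @ vs)"
      using Star xs by (simp add: simplex_Star)
    then show ?thesis
      unfolding split
      using alternating_move[OF alternating_coef[OF assms(1)], of us Star vs]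
        alternating_move[OF alternating_coef[OF assms(2)], of us Star vs] by simp
  next
    case False
    then obtain xs where "zs = map E xs"
      using map_E_exists by blast
    then show ?thesis
      using E zs by (auto simp: simplex_E)
  qed
qed

lemma star_sum_E:
  assumes "simplex X q (map E xs)"
  shows "star_sum n I q J (oriented_simplex (map E xs)) = 0"
  by (simp add: star_sum_def dual_cochain_oriented_simplex[OF assms])

text \<open>The signs of \<open>star_sum\<close> are those of bringing the omitted vertex to the
  front, which is why an average over prepended vertices results.\<close>

lemma star_sum_Star:
  assumes "simplex X q (Star # map E xs)"
  shows "star_sum n I q J (oriented_simplex (Star # map E xs))
    = avg I (\<lambda>ys. oriented_simplex ys (sorted_list_of_set J)) xs"
  unfolding star_sum_def avg_def face_list_def
  by (simp add: dual_cochain_oriented_simplex[OF assms] map_omit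
      sum_vertex_oriented_simplex[OF finite_I distinct_sorted_list_of_set])

text \<open>For fixed \<open>v\<close> this is \<open>sum_faces\<close> at \<open>v # xs\<close>,
  whence the length \<open>q\<close> instead of \<open>q + 1\<close>.\<close>

lemma sum_faces_avg:
  assumes "alternating F" "set xs \<subseteq> {0..n}" "int (length xs) = q"
  shows "(\<Sum>J | J \<in> faces n q \<and> P J.
      F (sorted_list_of_set J) * avg I (\<lambda>ys. oriented_simplex ys (sorted_list_of_set J)) xs)
    = avg I (\<lambda>ys. if P (set ys) then F ys else 0) xs"
proof -
  have "(\<Sum>J | J \<in> faces n q \<and> P J.
      F (sorted_list_of_set J) * avg I (\<lambda>ys. oriented_simplex ys (sorted_list_of_set J)) xs)
    = (\<Sum>v\<in>I. \<Sum>J | J \<in> faces n q \<and> P J.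
        F (sorted_list_of_set J) * oriented_simplex (v # xs) (sorted_list_of_set J)) / real (card I)"
    unfolding avg_def by (subst sum.swap) (simp add: sum_distrib_left sum_divide_distrib)
  also have "\<dots> = avg I (\<lambda>ys. if P (set ys) then F ys else 0) xs"
    unfolding avg_def
    using assms I_subset
    by (intro arg_cong2[of _ _ _ _ "(/)"] sum.cong refl sum_faces) auto
  finally show ?thesis .
qed

end

lemma finite_faces: "finite {J. J \<in> faces n q \<and> P J}"
  by (rule finite_subset[of _ "Pow {0..n}"]) (auto simp: faces_def)

lemma sum_faces_filter:
  fixes f g :: "nat set \<Rightarrow> real"
  assumes "\<And>J. J \<in> faces n q \<Longrightarrow> P J \<Longrightarrow> Q J \<and> f J = g J"
    and "\<And>J. J \<in> faces n q \<Longrightarrow> Q J \<Longrightarrow> \<not> P J \<Longrightarrow> f J = 0"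
  shows "(\<Sum>J | J \<in> faces n q \<and> Q J. f J) = (\<Sum>J | J \<in> faces n q \<and> P J. g J)"
  using assms by (intro sum.mono_neutral_cong_right finite_faces) auto

text \<open>The case \<open>I = {m}\<close> of \<open>sum_vertex_oriented_simplex\<close>. At most
  one index contributes, but a sum over all positions can be interchanged with one over faces and
  then becomes \<open>codiff\<close>.\<close>

lemma oriented_simplex_Cons_right:
  assumes "distinct xs" "m \<notin> set ys"
  shows "oriented_simplex xs (m # ys)
    = (\<Sum>i<length xs. (-1) ^ i * (if xs ! i = m then oriented_simplex (omit i xs) ys else 0))"
proof -
  have "oriented_simplex xs (m # ys)
      = (\<Sum>i | i < length xs \<and> xs ! i \<in> {m}. (-1) ^ i * oriented_simplex ys (omit i xs))"
    using sum_vertex_oriented_simplex[of "{m}" xs ys] assms(1)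
    by (simp add: oriented_simplex_commute[of xs])
  also have "\<dots> = (\<Sum>i<length xs. (-1) ^ i * (if xs ! i = m then oriented_simplex (omit i xs) ys else 0))"
    by (intro sum.mono_neutral_cong_left)
      (auto simp: oriented_simplex_commute[of ys])
  finally show ?thesis .
qed

lemma alternating_coef_E: "\<alpha> \<in> cochains Y q \<Longrightarrow> alternating (\<lambda>xs. coef \<alpha> (map E xs))"
  by (intro alternating_map alternating_coef)

lemma alternating_coef_Star:
  "\<alpha> \<in> cochains Y q \<Longrightarrow> alternating (\<lambda>xs. coef \<alpha> (Star # map E xs))"
  using alternating_map[OF alternating_Cons[OF alternating_coef]] .

lemma codiff_coef_E: "codiff (coef \<alpha>) (map E xs) = codiff (\<lambda>ys. coef \<alpha> (map E ys)) xs"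
  by (simp add: codiff_def map_omit)

lemma codiff_coef_Star:
  "codiff (coef \<alpha>) (Star # map E xs)
    = coef \<alpha> (map E xs) - codiff (\<lambda>ys. coef \<alpha> (Star # map E ys)) xs"
  unfolding codiff_Cons by (simp add: codiff_def map_omit)

section \<open>Inclusion, homotopy and projection in coefficients\<close>

context stellar
begin

lemma star_sum_cochain: "star_sum n I q J \<in> cochains X q"
  unfolding star_sum_def
  by (intro cochains_scale cochains_sum dual_cochain_in_cochains)

lemma incl_face_cochain: "incl_face n I q J \<in> cochains X q"
  unfolding incl_face_def
  by (cases "I \<subseteq> J") (simp_all add: star_sum_cochain cochains_add dual_cochain_in_cochains)

lemma proj_star_face_cochain: "proj_star_face n I q J \<in> cochains D q"
  by (simp add: proj_star_face_def dual_cochain_in_cochains cochains_zero)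

lemma welding_incl_cochain: "welding_incl n I q \<beta> \<in> cochains X q"
  unfolding welding_incl_def by (intro cochains_scale cochains_sum incl_face_cochain)

lemma welding_proj_cochain: "welding_proj n I q \<alpha> \<in> cochains D q"
  unfolding welding_proj_def stellar_extend_def proj_face_def
  by (intro cochains_add cochains_scale cochains_sum proj_star_face_cochain dual_cochain_in_cochains)

lemma welding_htpy_cochain: "welding_htpy n I q \<alpha> \<in> cochains X (q - 1)"
proof -
  have "htpy_star_face n I q J \<in> cochains X (q - 1)" for J
    using cochains_scale[OF star_sum_cochain, of "-1"] by (simp add: htpy_star_face_def)
  then show ?thesis
    unfolding welding_htpy_def stellar_extend_def htpy_face_def
    by (intro cochains_add cochains_scale cochains_sum cochains_zero)
qed

lemma coef_welding_incl_E:
  assumes \<beta>: "\<beta> \<in> cochains D q" and nI: "\<not> I \<subseteq> set xs"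
  shows "coef (welding_incl n I q \<beta>) (map E xs) = coef \<beta> (map E xs)"
proof (cases "simplex X q (map E xs)")
  case True
  then have xs: "set xs \<subseteq> {0..n}" "int (length xs) = q + 1" "xs \<noteq> []"
    by (simp_all add: simplex_E)
  have "coef (welding_incl n I q \<beta>) (map E xs)
      = (\<Sum>J | J \<in> faces n q \<and> J \<noteq> {}. coef \<beta> (map E (sorted_list_of_set J))
          * (if I \<subseteq> J then 0 else oriented_simplex xs (sorted_list_of_set J)))"
    by (simp add: coef_def welding_incl_def incl_face_def star_sum_E[OF True] face_list_def
        dual_cochain_oriented_simplex[OF True] cong: if_cong)
  also have "\<dots> = (\<Sum>J | J \<in> faces n q \<and> (J \<noteq> {} \<and> \<not> I \<subseteq> J). coef \<beta> (map E (sorted_list_of_set J))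
          * oriented_simplex xs (sorted_list_of_set J))"
    by (rule sum_faces_filter) auto
  also have "\<dots> = coef \<beta> (map E xs)"
    unfolding sum_faces[OF alternating_coef_E[OF \<beta>] xs(1,2)] using xs(3) nI by simp
  finally show ?thesis .
next
  case False
  then have "\<not> simplex D q (map E xs)"
    using nI by (simp add: simplex_E simplex_simplex_complex)
  then show ?thesis
    using coef_not_simplex[OF welding_incl_cochain False] coef_not_simplex[OF \<beta>] by simp
qed

lemma coef_welding_incl_Star:
  assumes \<beta>: "\<beta> \<in> cochains D q"
  shows "coef (welding_incl n I q \<beta>) (Star # map E xs) = avg I (\<lambda>ys. coef \<beta> (map E ys)) xs"
proof (cases "simplex X q (Star # map E xs)")
  case True
  then have xs: "set xs \<subseteq> {0..n}" "int (length xs) = q"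
    by (simp_all add: simplex_Star)
  have "coef (welding_incl n I q \<beta>) (Star # map E xs)
      = (\<Sum>J | J \<in> faces n q \<and> J \<noteq> {}. coef \<beta> (map E (sorted_list_of_set J))
          * avg I (\<lambda>ys. oriented_simplex ys (sorted_list_of_set J)) xs)"
    by (simp add: coef_def welding_incl_def incl_face_def star_sum_Star[OF True] face_list_def
        dual_cochain_oriented_simplex[OF True] cong: if_cong)
  also have "\<dots> = avg I (\<lambda>ys. coef \<beta> (map E ys)) xs"
    unfolding sum_faces_avg[OF alternating_coef_E[OF \<beta>] xs] by (rule avg_cong) simp
  finally show ?thesis .
next
  case False
  \<comment> \<open>If \<open>xs\<close> contains \<open>I\<close>, then \<open>v # xs\<close>
    repeats \<open>v\<close>; any other defect of \<open>xs\<close> is inherited by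
    \<open>v # xs\<close>.\<close>
  have "avg I (\<lambda>ys. coef \<beta> (map E ys)) xs = 0"
  proof (rule avg_zero)
    fix v assume "v \<in> I"
    then have "\<not> simplex D q (map E (v # xs))"
      using False by (auto simp: simplex_Star simplex_simplex_complex simp del: list.map)
    then show "coef \<beta> (map E (v # xs)) = 0"
      by (rule coef_not_simplex[OF \<beta>])
  qed
  then show ?thesis
    using coef_not_simplex[OF welding_incl_cochain False] by simp
qed

lemma coef_Star_zero:
  assumes "\<alpha> \<in> cochains X q" "I \<subseteq> set xs"
  shows "coef \<alpha> (Star # map E xs) = 0"
  by (rule coef_not_simplex[OF assms(1)]) (simp add: simplex_Star assms(2) del: list.map)

lemma coef_welding_htpy_E:
  "coef (welding_htpy n I q \<alpha>) (map E xs) = 0"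
proof (cases "simplex X (q - 1) (map E xs)")
  case True
  then show ?thesis
    by (simp add: coef_def welding_htpy_def stellar_extend_def htpy_face_def htpy_star_face_def
        star_sum_E)
qed (rule coef_not_simplex[OF welding_htpy_cochain])

lemma coef_welding_htpy_Star:
  assumes \<alpha>: "\<alpha> \<in> cochains X q"
  shows "coef (welding_htpy n I q \<alpha>) (Star # map E xs)
    = - avg I (\<lambda>ys. coef \<alpha> (Star # map E ys)) xs"
proof (cases "simplex X (q - 1) (Star # map E xs)")
  case True
  then have xs: "set xs \<subseteq> {0..n}" "int (length xs) = q - 1"
    by (simp_all add: simplex_Star)
  have "coef (welding_htpy n I q \<alpha>) (Star # map E xs)
      = - (\<Sum>J | J \<in> faces n (q - 1) \<and> \<not> I \<subseteq> J. coef \<alpha> (Star # map E (sorted_list_of_set J))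
          * avg I (\<lambda>ys. oriented_simplex ys (sorted_list_of_set J)) xs)"
    by (simp add: coef_def welding_htpy_def stellar_extend_def htpy_face_def htpy_star_face_def
        star_sum_Star[OF True] face_list_def sum_negf)
  also have "\<dots> = - avg I (\<lambda>ys. coef \<alpha> (Star # map E ys)) xs"
    unfolding sum_faces_avg[OF alternating_coef_Star[OF \<alpha>] xs]
  proof (intro arg_cong[of _ _ uminus] avg_cong)
    fix v
    show "(if \<not> I \<subseteq> set (v # xs) then coef \<alpha> (Star # map E (v # xs)) else 0)
        = coef \<alpha> (Star # map E (v # xs))"
      using coef_Star_zero[OF \<alpha>, of "v # xs"] by simp
  qed
  finally show ?thesis .
next
  case False
  have "avg I (\<lambda>ys. coef \<alpha> (Star # map E ys)) xs = 0"
  proof (rule avg_zero)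
    fix v assume "v \<in> I"
    then have "\<not> simplex X q (Star # map E (v # xs))"
      using False by (auto simp: simplex_Star simp del: list.map)
    then show "coef \<alpha> (Star # map E (v # xs)) = 0"
      by (rule coef_not_simplex[OF \<alpha>])
  qed
  then show ?thesis
    using coef_not_simplex[OF welding_htpy_cochain False] by simp
qed

text \<open>If \<open>J\<close> lacks a single vertex of \<open>I\<close>, the value is nonzero only
  if this vertex is some \<open>xs ! i\<close> and \<open>J\<close> consists of the others.\<close>

lemma proj_star_face_coef:
  assumes "simplex D q (map E xs)" "J \<subseteq> {0..n}"
  shows "proj_star_face n I q J (oriented_simplex (map E xs))
    = (\<Sum>i<length xs. (-1) ^ i *
        (if I - J = {xs ! i} then oriented_simplex (omit i xs) (sorted_list_of_set J) else 0))"
proof (cases "card (I - J) = 1")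
  case True
  then obtain m where m: "I - J = {m}"
    by (metis card_1_singletonE)
  have "distinct xs"
    using assms(1) by (simp add: simplex_simplex_complex)
  moreover have "m \<notin> set (sorted_list_of_set J)"
    using m finite_subset[OF assms(2)] by auto
  moreover have "proj_star_face n I q J (oriented_simplex (map E xs))
      = oriented_simplex xs (m # sorted_list_of_set J)"
    using m dual_cochain_oriented_simplex[OF assms(1)] oriented_simplex_E[of xs "m # _"]
    by (simp add: proj_star_face_def face_list_def)
  ultimately show ?thesis
    by (simp add: oriented_simplex_Cons_right m eq_commute)
next
  case False
  then have "I - J \<noteq> {xs ! i}" for i
    by auto
  then show ?thesis
    using False by (simp add: proj_star_face_def)
qed

text \<open>Through \<open>Star\<close> only those \<open>omit i xs\<close> contribute from which
  \<open>xs ! i\<close> is the one missing vertex of \<open>I\<close>. They exist only if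
  \<open>xs\<close> contains \<open>I\<close>, and then the other terms of \<open>codiff\<close>
  vanish, since \<open>Star\<close> and a face containing \<open>I\<close> span no simplex.\<close>

lemma coef_welding_proj:
  assumes \<alpha>: "\<alpha> \<in> cochains X q" and sub: "set xs \<subseteq> {0..n}"
  shows "coef (welding_proj n I q \<alpha>) (map E xs)
    = (if I \<subseteq> set xs then codiff (\<lambda>ys. coef \<alpha> (Star # map E ys)) xs else coef \<alpha> (map E xs))"
proof (cases "simplex D q (map E xs)")
  case True
  let ?A = "\<lambda>xs. coef \<alpha> (Star # map E xs)"
  let ?s = sorted_list_of_set
  have xs: "distinct xs" "xs \<noteq> []" "int (length xs) = q + 1"
    using True by (simp_all add: simplex_simplex_complex)
  have len: "int (length (omit i xs)) = (q - 1) + 1" if "i < length xs" for i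
    using that xs(3) by (simp add: length_omit)
  have "coef (welding_proj n I q \<alpha>) (map E xs)
      = (\<Sum>J | J \<in> faces n q \<and> (J \<noteq> {} \<and> \<not> I \<subseteq> J).
          coef \<alpha> (map E (?s J)) * oriented_simplex xs (?s J))
      + (\<Sum>J | J \<in> faces n (q - 1) \<and> \<not> I \<subseteq> J.
          ?A (?s J) * proj_star_face n I q J (oriented_simplex (map E xs)))"
    by (simp add: coef_def welding_proj_def stellar_extend_def proj_face_def face_list_def
        dual_cochain_oriented_simplex[OF True])
  also have "(\<Sum>J | J \<in> faces n q \<and> (J \<noteq> {} \<and> \<not> I \<subseteq> J).
          coef \<alpha> (map E (?s J)) * oriented_simplex xs (?s J))
      = (if I \<subseteq> set xs then 0 else coef \<alpha> (map E xs))"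
    unfolding sum_faces[OF alternating_coef_E[OF \<alpha>] sub xs(3)] using xs(2) by simp
  also have "(\<Sum>J | J \<in> faces n (q - 1) \<and> \<not> I \<subseteq> J.
          ?A (?s J) * proj_star_face n I q J (oriented_simplex (map E xs)))
      = (\<Sum>i<length xs. (-1) ^ i * (\<Sum>J | J \<in> faces n (q - 1) \<and> \<not> I \<subseteq> J.
          ?A (?s J) * (if I - J = {xs ! i} then oriented_simplex (omit i xs) (?s J) else 0)))"
    unfolding sum_distrib_left
    by (subst sum.swap) (intro sum.cong refl,
      simp add: proj_star_face_coef[OF True] faces_def sum_distrib_left mult.left_commute)
  \<comment> \<open>The new condition implies \<open>\<not> I \<subseteq> J\<close> and thus absorbs
    the old filter.\<close>
  also have "\<dots> = (\<Sum>i<length xs. (-1) ^ i * (\<Sum>J | J \<in> faces n (q - 1) \<and> I - J = {xs ! i}.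
          ?A (?s J) * oriented_simplex (omit i xs) (?s J)))"
    by (intro sum.cong refl arg_cong2[of _ _ _ _ "(*)"] sum_faces_filter) auto
  also have "\<dots> = (\<Sum>i<length xs. (-1) ^ i *
      (if I - set (omit i xs) = {xs ! i} then ?A (omit i xs) else 0))"
    using sub set_omit[OF xs(1)] len
    by (intro sum.cong refl arg_cong2[of _ _ _ _ "(*)"] sum_faces alternating_coef_Star[OF \<alpha>]) auto
  also have "\<dots> = (if I \<subseteq> set xs then codiff ?A xs else 0)"
  proof (cases "I \<subseteq> set xs")
    case True
    have "(if I - set (omit i xs) = {xs ! i} then ?A (omit i xs) else 0) = ?A (omit i xs)"
      if "i < length xs" for i
    proof (cases "I - set (omit i xs) = {xs ! i}")
      case False
      \<comment> \<open>Here \<open>xs ! i\<close> lies outside \<open>I\<close>, so omitting it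
        keeps all of \<open>I\<close>.\<close>
      then have "I \<subseteq> set (omit i xs)"
        using set_omit[OF xs(1) that] True by auto
      then show ?thesis
        using coef_Star_zero[OF \<alpha>] by simp
    qed simp
    then show ?thesis
      using True by (simp add: codiff_def)
  next
    case False
    have "I - set (omit i xs) \<noteq> {xs ! i}" if i: "i < length xs" for i
    proof
      assume "I - set (omit i xs) = {xs ! i}"
      then have "I \<subseteq> insert (xs ! i) (set (omit i xs))"
        by blast
      also have "\<dots> \<subseteq> set xs"
        using set_omit[OF xs(1) i] nth_mem[OF i] by simp
      finally show False
        using False by simp
    qed
    then show ?thesis
      using False by simp
  qed
  finally show ?thesis
    by simp
next
  case False
  have "(if I \<subseteq> set xs then codiff (\<lambda>ys. coef \<alpha> (Star # map E ys)) xs else coef \<alpha> (map E xs)) = 0"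
  proof (cases "I \<subseteq> set xs")
    case True
    have "codiff (\<lambda>ys. coef \<alpha> (Star # map E ys)) xs = 0"
    proof (cases "distinct xs")
      case dist: True
      have "xs \<noteq> []"
        using True I_nonempty by auto
      then have "int (length xs) \<noteq> q + 1"
        using False dist sub by (simp add: simplex_simplex_complex)
      then have "\<not> simplex X q (Star # map E (omit i xs))" if "i < length xs" for i
        using that by (simp add: simplex_Star length_omit del: list.map)
      then show ?thesis
        using coef_not_simplex[OF \<alpha>] by (simp add: codiff_def)
    qed (rule alternating_not_distinct[OF alternating_codiff[OF alternating_coef_Star[OF \<alpha>]]])
    then show ?thesis
      using True by simp
  next
    case nI: False
    then have "\<not> simplex X q (map E xs)"
      using False by (simp add: simplex_E simplex_simplex_complex)
    then show ?thesis
      using nI coef_not_simplex[OF \<alpha>] by simp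
  qed
  then show ?thesis
    using coef_not_simplex[OF welding_proj_cochain False] by simp
qed

lemma coef_coboundary_D:
  assumes "\<beta> \<in> cochains D q" "set xs \<subseteq> {0..n}"
  shows "coef (coboundary D q \<beta>) (map E xs) = codiff (\<lambda>ys. coef \<beta> (map E ys)) xs"
  unfolding codiff_coef_E[symmetric]
  by (rule coef_coboundary_not_degenerate[OF is_complex_simplex_complex assms(1)])
    (use assms(2) in \<open>auto simp: simplex_complex_def\<close>)

lemma coef_coboundary_E:
  assumes "\<alpha> \<in> cochains X q" "set xs \<subseteq> {0..n}" "\<not> I \<subseteq> set xs"
  shows "coef (coboundary X q \<alpha>) (map E xs) = codiff (\<lambda>ys. coef \<alpha> (map E ys)) xs"
  unfolding codiff_coef_E[symmetric]
  by (rule coef_coboundary_not_degenerate[OF is_complex_X assms(1)])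
    (use assms(2,3) in \<open>auto simp: E_image_in_X\<close>)

lemma coef_coboundary_Star:
  assumes "\<alpha> \<in> cochains X q" "set xs \<subseteq> {0..n}" "\<not> I \<subseteq> set xs"
  shows "coef (coboundary X q \<alpha>) (Star # map E xs)
    = coef \<alpha> (map E xs) - codiff (\<lambda>ys. coef \<alpha> (Star # map E ys)) xs"
  unfolding codiff_coef_Star[symmetric]
  by (rule coef_coboundary_not_degenerate[OF is_complex_X assms(1)])
    (use assms(2,3) in \<open>auto simp: insert_Star_in_X\<close>)

end

section \<open>The special deformation retraction\<close>

text \<open>The second premise concerns arbitrary functions: the welding maps only evaluate their
  argument at elementary chains, so their linearity is not confined to cochains.\<close>

lemma linear_map_onI:
  assumes "\<And>\<alpha>. \<alpha> \<in> V \<Longrightarrow> f \<alpha> \<in> W"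
    and "\<And>\<alpha> \<beta> r s y. f (\<lambda>x. r * \<alpha> x + s * \<beta> x) y = r * f \<alpha> y + s * f \<beta> y"
  shows "linear_map_on V W f"
  unfolding linear_map_on_def using assms by auto

lemma stellar_extend_lincomb:
  "stellar_extend n I f g q (\<lambda>x. r * \<alpha> x + s * \<beta> x) c
    = r * stellar_extend n I f g q \<alpha> c + s * stellar_extend n I f g q \<beta> c"
  unfolding stellar_extend_def
  by (simp add: distrib_right distrib_left sum.distrib sum_distrib_left mult.assoc)

lemma welding_incl_lincomb:
  "welding_incl n I q (\<lambda>x. r * \<alpha> x + s * \<beta> x) c
    = r * welding_incl n I q \<alpha> c + s * welding_incl n I q \<beta> c"
  unfolding welding_incl_def
  by (simp add: distrib_right sum.distrib sum_distrib_left mult.assoc)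

context stellar
begin

lemma codiff_insert_zero:
  assumes "alternating F" "v \<in> set xs"
  shows "codiff F (v # xs) = 0"
  using assms by (intro alternating_not_distinct alternating_codiff) auto

text \<open>Every \<open>v\<close> in \<open>I\<close> is repeated in \<open>v # xs\<close>, and
  \<open>codiff F\<close> is alternating.\<close>

lemma avg_codiff_full:
  assumes "alternating F" "I \<subseteq> set xs"
  shows "avg I (codiff F) xs = 0"
  using assms by (intro avg_zero codiff_insert_zero) auto

lemma subset_Cons: "v \<in> I \<Longrightarrow> set xs \<subseteq> {0..n} \<Longrightarrow> set (v # xs) \<subseteq> {0..n}"
  using I_subset by auto

lemma linear_welding_incl: "linear_map_on (cochains D q) (cochains X q) (welding_incl n I q)"
  by (rule linear_map_onI) (simp_all add: welding_incl_cochain welding_incl_lincomb)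

lemma linear_welding_proj: "linear_map_on (cochains X q) (cochains D q) (welding_proj n I q)"
  by (rule linear_map_onI) (simp_all add: welding_proj_cochain, simp add: welding_proj_def stellar_extend_lincomb)

lemma linear_welding_htpy: "linear_map_on (cochains X q) (cochains X (q - 1)) (welding_htpy n I q)"
  by (rule linear_map_onI) (simp_all add: welding_htpy_cochain, simp add: welding_htpy_def stellar_extend_lincomb)

text \<open>Without \<open>Star\<close> both sides are \<open>codiff\<close> of the coefficients, as
  omitting entries cannot make a list contain \<open>I\<close>; with \<open>Star\<close> the claim
  is \<open>codiff_avg\<close>.\<close>

lemma welding_incl_coboundary:
  assumes \<beta>: "\<beta> \<in> cochains D q"
  shows "coboundary X q (welding_incl n I q \<beta>) = welding_incl n I (q + 1) (coboundary D q \<beta>)"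
proof (rule stellar_cochain_eqI)
  have incl: "welding_incl n I q \<beta> \<in> cochains X q"
    by (rule welding_incl_cochain)
  have d\<beta>: "coboundary D q \<beta> \<in> cochains D (q + 1)"
    by (rule coboundary_cochain[OF is_complex_simplex_complex \<beta>])
  show "coboundary X q (welding_incl n I q \<beta>) \<in> cochains X (q + 1)"
    by (rule coboundary_cochain[OF is_complex_X incl])
  show "welding_incl n I (q + 1) (coboundary D q \<beta>) \<in> cochains X (q + 1)"
    by (rule welding_incl_cochain)
  fix xs assume xs: "distinct xs" "set xs \<subseteq> {0..n}" "\<not> I \<subseteq> set xs"
  let ?B = "\<lambda>xs. coef \<beta> (map E xs)"
  have "codiff (\<lambda>ys. coef (welding_incl n I q \<beta>) (map E ys)) xs = codiff ?B xs"
    using xs set_omit[OF xs(1)] by (intro codiff_cong coef_welding_incl_E[OF \<beta>]) auto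
  then show "coef (coboundary X q (welding_incl n I q \<beta>)) (map E xs)
      = coef (welding_incl n I (q + 1) (coboundary D q \<beta>)) (map E xs)"
    using xs by (simp add: coef_coboundary_E[OF incl] coef_welding_incl_E[OF d\<beta>] coef_coboundary_D[OF \<beta>])
  have "coef (coboundary X q (welding_incl n I q \<beta>)) (Star # map E xs) = ?B xs - codiff (avg I ?B) xs"
    using xs by (simp add: coef_coboundary_Star[OF incl] coef_welding_incl_E[OF \<beta>]
        coef_welding_incl_Star[OF \<beta>])
  also have "\<dots> = avg I (codiff ?B) xs"
    using codiff_avg[OF finite_I I_nonempty, of ?B xs] by simp
  also have "\<dots> = avg I (\<lambda>ys. coef (coboundary D q \<beta>) (map E ys)) xs"
    by (rule avg_cong) (use coef_coboundary_D[OF \<beta> subset_Cons] xs in simp)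
  also have "\<dots> = coef (welding_incl n I (q + 1) (coboundary D q \<beta>)) (Star # map E xs)"
    by (simp add: coef_welding_incl_Star[OF d\<beta>])
  finally show "coef (coboundary X q (welding_incl n I q \<beta>)) (Star # map E xs)
      = coef (welding_incl n I (q + 1) (coboundary D q \<beta>)) (Star # map E xs)" .
qed

lemma welding_proj_coboundary:
  assumes \<alpha>: "\<alpha> \<in> cochains X q"
  shows "coboundary D q (welding_proj n I q \<alpha>) = welding_proj n I (q + 1) (coboundary X q \<alpha>)"
proof (rule simplex_complex_cochain_eqI)
  have proj: "welding_proj n I q \<alpha> \<in> cochains D q"
    by (rule welding_proj_cochain)
  have d\<alpha>: "coboundary X q \<alpha> \<in> cochains X (q + 1)"
    by (rule coboundary_cochain[OF is_complex_X \<alpha>])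
  show "coboundary D q (welding_proj n I q \<alpha>) \<in> cochains D (q + 1)"
    by (rule coboundary_cochain[OF is_complex_simplex_complex proj])
  show "welding_proj n I (q + 1) (coboundary X q \<alpha>) \<in> cochains D (q + 1)"
    by (rule welding_proj_cochain)
  fix xs assume xs: "distinct xs" "set xs \<subseteq> {0..n}"
  let ?A = "\<lambda>xs. coef \<alpha> (map E xs)" and ?S = "\<lambda>xs. coef \<alpha> (Star # map E xs)"
  let ?p = "\<lambda>ys. coef (welding_proj n I q \<alpha>) (map E ys)"
  have sub: "set (omit i xs) \<subseteq> {0..n}" "set (omit i xs) \<subseteq> set xs" if "i < length xs" for i
    using xs set_omit[OF xs(1) that] by auto
  show "coef (coboundary D q (welding_proj n I q \<alpha>)) (map E xs)
      = coef (welding_proj n I (q + 1) (coboundary X q \<alpha>)) (map E xs)"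
  proof (cases "I \<subseteq> set xs")
    case True
    \<comment> \<open>If \<open>omit i xs\<close> contains \<open>I\<close>, the projection equals
      \<open>codiff ?S\<close> there and both sides are 0. Applying \<open>codiff\<close> once more
      then leaves only the projection.\<close>
    have omit: "coef (coboundary X q \<alpha>) (Star # map E (omit i xs))
        = ?p (omit i xs) - codiff ?S (omit i xs)" if i: "i < length xs" for i
    proof (cases "I \<subseteq> set (omit i xs)")
      case True
      then show ?thesis
        using coef_Star_zero[OF d\<alpha> True] by (simp add: coef_welding_proj[OF \<alpha> sub(1)[OF i]])
    next
      case False
      then show ?thesis
        by (simp add: coef_welding_proj[OF \<alpha> sub(1)[OF i]] coef_coboundary_Star[OF \<alpha> sub(1)[OF i]])
    qed
    have "codiff (\<lambda>ys. coef (coboundary X q \<alpha>) (Star # map E ys)) xs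
        = codiff (\<lambda>ys. ?p ys - codiff ?S ys) xs"
      by (rule codiff_cong) (rule omit)
    then have "coef (welding_proj n I (q + 1) (coboundary X q \<alpha>)) (map E xs)
        = codiff (\<lambda>ys. ?p ys - codiff ?S ys) xs"
      unfolding coef_welding_proj[OF d\<alpha> xs(2)] using True by simp
    then show ?thesis
      by (simp add: codiff_diff codiff_codiff coef_coboundary_D[OF proj xs(2)])
  next
    case False
    have "codiff ?p xs = codiff ?A xs"
    proof (rule codiff_cong)
      fix i assume i: "i < length xs"
      then have "\<not> I \<subseteq> set (omit i xs)"
        using False sub(2)[OF i] by blast
      then show "?p (omit i xs) = ?A (omit i xs)"
        by (simp add: coef_welding_proj[OF \<alpha> sub(1)[OF i]])
    qed
    then show ?thesis
      using False by (simp add: coef_welding_proj[OF d\<alpha> xs(2)] coef_coboundary_D[OF proj xs(2)]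
          coef_coboundary_E[OF \<alpha> xs(2)])
  qed
qed

text \<open>On a face containing \<open>I\<close>, the second term of \<open>codiff_avg\<close>
  averages over lists with repetitions, so the coefficient itself remains.\<close>

lemma welding_proj_incl:
  assumes \<beta>: "\<beta> \<in> cochains D q"
  shows "welding_proj n I q (welding_incl n I q \<beta>) = \<beta>"
proof (rule simplex_complex_cochain_eqI[OF welding_proj_cochain \<beta>])
  fix xs assume xs: "distinct xs" "set xs \<subseteq> {0..n}"
  let ?B = "\<lambda>xs. coef \<beta> (map E xs)"
  have "codiff (avg I ?B) xs = ?B xs" if "I \<subseteq> set xs"
    using codiff_avg[OF finite_I I_nonempty, of ?B xs]
      avg_codiff_full[OF alternating_coef_E[OF \<beta>] that] by simp
  then show "coef (welding_proj n I q (welding_incl n I q \<beta>)) (map E xs) = ?B xs"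
    using coef_welding_incl_E[OF \<beta>]
    by (simp add: coef_welding_proj[OF welding_incl_cochain xs(2)] coef_welding_incl_Star[OF \<beta>])
qed

text \<open>Without \<open>Star\<close> both sides are 0: the homotopy has no such coefficients, and
  inclusion after projection keeps those of \<alpha>. With \<open>Star\<close> two copies of
  \<open>avg I (codiff ?S)\<close> cancel, one from \<open>codiff_avg\<close> and one from the
  homotopy of the coboundary.\<close>

lemma welding_htpy_coboundary:
  assumes \<alpha>: "\<alpha> \<in> cochains X q"
  shows "(\<lambda>x. coboundary X (q - 1) (welding_htpy n I q \<alpha>) x
      + welding_htpy n I (q + 1) (coboundary X q \<alpha>) x)
    = (\<lambda>x. \<alpha> x - welding_incl n I q (welding_proj n I q \<alpha>) x)"
    (is "(\<lambda>x. ?da x + ?ad x) = (\<lambda>x. \<alpha> x - ?ip x)")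
proof (rule stellar_cochain_eqI)
  have htpy: "welding_htpy n I q \<alpha> \<in> cochains X (q - 1)"
    by (rule welding_htpy_cochain)
  have d\<alpha>: "coboundary X q \<alpha> \<in> cochains X (q + 1)"
    by (rule coboundary_cochain[OF is_complex_X \<alpha>])
  have proj: "welding_proj n I q \<alpha> \<in> cochains D q"
    by (rule welding_proj_cochain)
  show "(\<lambda>x. ?da x + ?ad x) \<in> cochains X q"
    using coboundary_cochain[OF is_complex_X htpy] welding_htpy_cochain[of "q + 1"]
    by (intro cochains_add) simp_all
  show "(\<lambda>x. \<alpha> x - ?ip x) \<in> cochains X q"
    by (intro cochains_diff \<alpha> welding_incl_cochain)
  fix xs assume xs: "distinct xs" "set xs \<subseteq> {0..n}" "\<not> I \<subseteq> set xs"
  let ?A = "\<lambda>xs. coef \<alpha> (map E xs)" and ?S = "\<lambda>xs. coef \<alpha> (Star # map E xs)"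
  have split: "coef (\<lambda>x. ?da x + ?ad x) zs = coef ?da zs + coef ?ad zs"
      "coef (\<lambda>x. \<alpha> x - ?ip x) zs = coef \<alpha> zs - coef ?ip zs" for zs
    by (simp_all add: coef_def)
  show "coef (\<lambda>x. ?da x + ?ad x) (map E xs) = coef (\<lambda>x. \<alpha> x - ?ip x) (map E xs)"
    unfolding split using xs
    by (simp add: coef_coboundary_E[OF htpy] coef_welding_htpy_E coef_welding_incl_E[OF proj]
        coef_welding_proj[OF \<alpha>] codiff_def)
  have da: "coef ?da (Star # map E xs) = ?S xs - avg I (codiff ?S) xs"
    using xs codiff_avg[OF finite_I I_nonempty, of ?S xs]
    by (simp add: coef_coboundary_Star[OF htpy] coef_welding_htpy_E coef_welding_htpy_Star[OF \<alpha>]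
        codiff_minus)
  \<comment> \<open>The list \<open>v # xs\<close> may contain \<open>I\<close> although
    \<open>xs\<close> does not; then both sides are 0.\<close>
  have vertex: "coef (coboundary X q \<alpha>) (Star # map E (v # xs))
      = coef (welding_proj n I q \<alpha>) (map E (v # xs)) - codiff ?S (v # xs)" if "v \<in> I" for v
  proof (cases "I \<subseteq> set (v # xs)")
    case True
    then show ?thesis
      using coef_Star_zero[OF d\<alpha> True] by (simp add: coef_welding_proj[OF \<alpha> subset_Cons[OF that xs(2)]] del: list.map)
  next
    case False
    then show ?thesis
      by (simp add: coef_welding_proj[OF \<alpha> subset_Cons[OF that xs(2)]]
          coef_coboundary_Star[OF \<alpha> subset_Cons[OF that xs(2)]] del: list.map)
  qed
  have "avg I (\<lambda>ys. coef (coboundary X q \<alpha>) (Star # map E ys)) xs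
      = avg I (\<lambda>ys. coef (welding_proj n I q \<alpha>) (map E ys) - codiff ?S ys) xs"
    by (rule avg_cong) (simp add: vertex del: list.map)
  then have "coef ?ad (Star # map E xs) = avg I (codiff ?S) xs - coef ?ip (Star # map E xs)"
    by (simp add: coef_welding_htpy_Star[OF d\<alpha>] coef_welding_incl_Star[OF proj] avg_diff)
  then show "coef (\<lambda>x. ?da x + ?ad x) (Star # map E xs) = coef (\<lambda>x. \<alpha> x - ?ip x) (Star # map E xs)"
    unfolding split da by simp
qed

lemma welding_htpy_htpy:
  assumes \<alpha>: "\<alpha> \<in> cochains X q"
  shows "welding_htpy n I (q - 1) (welding_htpy n I q \<alpha>) = (\<lambda>x. 0)"
proof (rule stellar_cochain_eqI[OF welding_htpy_cochain cochains_zero])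
  fix xs
  show "coef (welding_htpy n I (q - 1) (welding_htpy n I q \<alpha>)) (map E xs) = coef (\<lambda>x. 0) (map E xs)"
    by (simp add: coef_welding_htpy_E coef_def[of "\<lambda>x. 0"])
  show "coef (welding_htpy n I (q - 1) (welding_htpy n I q \<alpha>)) (Star # map E xs)
      = coef (\<lambda>x. 0) (Star # map E xs)"
    using avg_avg[OF alternating_coef_Star[OF \<alpha>], of I xs]
    by (simp add: coef_welding_htpy_Star[OF welding_htpy_cochain] coef_welding_htpy_Star[OF \<alpha>]
        avg_minus coef_def[of "\<lambda>x. 0"])
qed

text \<open>The inclusion averages over \<open>I\<close> once and the homotopy a second
  time.\<close>

lemma welding_htpy_incl:
  assumes \<beta>: "\<beta> \<in> cochains D q"
  shows "welding_htpy n I q (welding_incl n I q \<beta>) = (\<lambda>x. 0)"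
proof (rule stellar_cochain_eqI[OF welding_htpy_cochain cochains_zero])
  fix xs
  show "coef (welding_htpy n I q (welding_incl n I q \<beta>)) (map E xs) = coef (\<lambda>x. 0) (map E xs)"
    by (simp add: coef_welding_htpy_E coef_def[of "\<lambda>x. 0"])
  show "coef (welding_htpy n I q (welding_incl n I q \<beta>)) (Star # map E xs)
      = coef (\<lambda>x. 0) (Star # map E xs)"
    using avg_avg[OF alternating_coef_E[OF \<beta>], of I xs]
    by (simp add: coef_welding_htpy_Star[OF welding_incl_cochain] coef_welding_incl_Star[OF \<beta>]
        coef_def[of "\<lambda>x. 0"])
qed

text \<open>On faces not containing \<open>I\<close> the homotopy has no coefficients. On the others
  \<open>codiff_avg\<close> leaves the coefficient of \<alpha> after \<open>Star\<close>, where
  there is no simplex, and an average over lists with repetitions; both are 0.\<close>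

lemma welding_proj_htpy:
  assumes \<alpha>: "\<alpha> \<in> cochains X q"
  shows "welding_proj n I (q - 1) (welding_htpy n I q \<alpha>) = (\<lambda>x. 0)"
proof (rule simplex_complex_cochain_eqI[OF welding_proj_cochain cochains_zero])
  fix xs assume xs: "set xs \<subseteq> {0..n}"
  let ?S = "\<lambda>xs. coef \<alpha> (Star # map E xs)"
  have "codiff (avg I ?S) xs = 0" if "I \<subseteq> set xs"
    using codiff_avg[OF finite_I I_nonempty, of ?S xs] coef_Star_zero[OF \<alpha> that]
      avg_codiff_full[OF alternating_coef_Star[OF \<alpha>] that] by simp
  then show "coef (welding_proj n I (q - 1) (welding_htpy n I q \<alpha>)) (map E xs)
      = coef (\<lambda>x. 0) (map E xs)"
    by (simp add: coef_welding_proj[OF welding_htpy_cochain xs] coef_welding_htpy_E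
        coef_welding_htpy_Star[OF \<alpha>] codiff_minus coef_def[of "\<lambda>x. 0"])
qed

end

theorem mainTheorem7:
  fixes n k :: nat and I :: "nat set"
  assumes "k \<le> n" and "I \<subseteq> {0..n}" and "card I = k + 1"
  shows "special_deformation_retraction
           (cochains (stellar_subdivision n I)) (coboundary (stellar_subdivision n I))
           (cochains (simplex_complex n)) (coboundary (simplex_complex n))
           (welding_incl n I) (welding_proj n I) (welding_htpy n I)"
proof -
  interpret stellar n I
    using assms by unfold_locales auto
  show ?thesis
    unfolding special_deformation_retraction_def cochain_map_def
    by (intro conjI allI ballI linear_welding_incl linear_welding_proj linear_welding_htpy
        welding_incl_coboundary welding_proj_coboundary welding_proj_incl welding_htpy_coboundary
        welding_htpy_htpy welding_htpy_incl welding_proj_htpy)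
qed

end
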